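(* Let $X\subset\mathbb{R}^n$ be closed, bounded and convex, with $\|x\|\le M$ for all $x\in X$ ($M>0$). Let $F(x)=\mathbb{E}[\Phi(x,\xi)]$ be monotone and continuous on $X^\epsilon$, suppose $\mathbb{E}[\|\Phi(x,\xi)\|^2]\le C^2$ for all $x\in X^\epsilon$ with some $C>0$, and suppose the solution set of VI$(X,F)$ is nonempty. Let $\xi_0,\xi_1,\dots$ be i.i.d. copies of $\xi$, independent of $x_0$. Let $r\le1$, and set $\mathbb{1}_r=0$ if $r\ge1$ and $\mathbb{1}_r=1$ if $r<1$. Let the stepsizes be $$\gamma_k=\frac{2M\sqrt{1+\mathbb{1}_r}}{C\sqrt{k+1}},\qquad k\ge0,$$ and let $\bar x_N^\ell(r)$ be generated by the aSA$_{\ell,r}$ algorithm with $\ell=\lceil\lambda N\rceil$ for a fixed $\lambda\in(0,1)$ and $N>\frac{2}{1-\lambda}$. Then: (a) For $r=1$, $\mathbb{E}[\mathrm{G}(\bar x_N^\ell(r))]=\mathcal{O}\left(\frac1{\sqrt N}\right)$. (b) For any $r<1$, $\mathbb{E}[\mathrm{G}(\bar x_N^\ell(r))]=\mathcal{O}\left(\frac1{\sqrt N}\right)$. (c) Define, with $\ell=\lceil\lambda N\rceil$ and the stepsizes $\gamma_k=\frac{2M\sqrt{1+\mathbb{1}_r}}{C\sqrt{k+1}}$, $k\ge0$ (which depend on $r$ through $\mathbb{1}_r$), $$TUB(r,\lambda,N)=\frac{1}{\sum_{k=\ell}^{N-1}\gamma_k^r}\left(4M^2\big(\gamma_\ell^{r-1}+\gamma_{N-1}^{r-1}\mathbb{1}_r\big)+C^2\sum_{k=\ell}^{N-1}\gamma_k^{r+1}\right).$$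 Then for any $r<1$ there exist $\bar\lambda\in(0,1)$ and $\bar N\ge1$ such that $TUB(r,\lambda,N)\le TUB(1,\lambda,N)$ for all $\lambda\in(0,\bar\lambda)$ and all $N>\bar N$.
   Context: $\|\cdot\|$ is the Euclidean norm, $\Pi_X$ is Euclidean projection onto $X$. $\epsilon\ge0$ is fixed and $X^\epsilon=X+\{z\in\mathbb{R}^n:\|z\|\le\epsilon\}$ (so $X^0=X$; no smoothing is used here). $\xi$ is an $\mathbb{R}^d$-valued random vector, $\Phi:X^\epsilon\times\mathbb{R}^d\to\mathbb{R}^n$. VI$(X,F)$ asks for $x^*\in X$ with $F(x^* )^T(x-x^* )\ge0$ for all $x\in X$. aSA$_{\ell,r}$ algorithm: $x_0\in X$ is a random vector with $\mathbb{E}[\|x_0\|^2]<\infty$, $x_{k+1}=\Pi_X\big(x_k-\gamma_k\Phi(x_k,\xi_k)\big)$ for $k\ge0$, and $\bar x_N^\ell(r)=\frac{\sum_{t=\ell}^{N-1}\gamma_t^rx_t}{\sum_{t=\ell}^{N-1}\gamma_t^r}$ for $\ell\le N-1$. Gap function: $\mathrm{G}(x)=\sup_{y\in X}F(y)^T(x-y)$ for $x\in X$. *)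

theory Defs
  imports "HOL-Probability.Probability" "HOL-Library.Landau_Symbols"
begin

definition enlargement :: "'a::real_normed_vector set \<Rightarrow> real \<Rightarrow> 'a set" where
  "enlargement X \<epsilon> = {x + z | x z. x \<in> X \<and> norm z \<le> \<epsilon>}"

definition monotone_operator_on :: "'a::real_inner set \<Rightarrow> ('a \<Rightarrow> 'a) \<Rightarrow> bool" where
  "monotone_operator_on S F \<longleftrightarrow> (\<forall>x\<in>S. \<forall>y\<in>S. (F x - F y) \<bullet> (x - y) \<ge> 0)"

definition VI_solutions :: "'a::real_inner set \<Rightarrow> ('a \<Rightarrow> 'a) \<Rightarrow> 'a set" where
  "VI_solutions X F = {xs \<in> X. \<forall>x\<in>X. F xs \<bullet> (x - xs) \<ge> 0}"

text \<open>The real-valued supremum below is the mathematical one only when the set of values is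
  bounded above, e.g. for nonempty compact X and F continuous on X.\<close>

definition gap :: "'a::real_inner set \<Rightarrow> ('a \<Rightarrow> 'a) \<Rightarrow> 'a \<Rightarrow> real" where
  "gap X F x = (SUP y\<in>X. F y \<bullet> (x - y))"

text \<open>Independence of two random variables that may take values in different types;
  the library's \<open>indep_var\<close> requires a common value type. The right-hand side is the
  one of \<open>indep_var_eq\<close>.\<close>

definition indep_random_variables ::
  "'w measure \<Rightarrow> 'a measure \<Rightarrow> ('w \<Rightarrow> 'a) \<Rightarrow> 'b measure \<Rightarrow> ('w \<Rightarrow> 'b) \<Rightarrow> bool" where
  "indep_random_variables P S U T V \<longleftrightarrow>
     U \<in> measurable P S \<and> V \<in> measurable P T \<and>
     prob_space.indep_set P
       (sigma_sets (space P) {U -` A \<inter> space P | A. A \<in> sets S})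
       (sigma_sets (space P) {V -` A \<inter> space P | A. A \<in> sets T})"

primrec SA_iterate ::
  "'a::euclidean_space set \<Rightarrow> ('a \<Rightarrow> 'b \<Rightarrow> 'a) \<Rightarrow> (nat \<Rightarrow> real) \<Rightarrow>
   ('w \<Rightarrow> 'a) \<Rightarrow> (nat \<Rightarrow> 'w \<Rightarrow> 'b) \<Rightarrow> nat \<Rightarrow> 'w \<Rightarrow> 'a" where
  "SA_iterate X \<Phi> \<gamma> x0 \<xi> 0 \<omega> = x0 \<omega>"
| "SA_iterate X \<Phi> \<gamma> x0 \<xi> (Suc k) \<omega> =
     closest_point X
       (SA_iterate X \<Phi> \<gamma> x0 \<xi> k \<omega> - \<gamma> k *\<^sub>R \<Phi> (SA_iterate X \<Phi> \<gamma> x0 \<xi> k \<omega>) (\<xi> k \<omega>))"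

definition aSA_average ::
  "'a::euclidean_space set \<Rightarrow> ('a \<Rightarrow> 'b \<Rightarrow> 'a) \<Rightarrow> (nat \<Rightarrow> real) \<Rightarrow>
   ('w \<Rightarrow> 'a) \<Rightarrow> (nat \<Rightarrow> 'w \<Rightarrow> 'b) \<Rightarrow> nat \<Rightarrow> real \<Rightarrow> nat \<Rightarrow> 'w \<Rightarrow> 'a" where
  "aSA_average X \<Phi> \<gamma> x0 \<xi> l r N \<omega> =
     (\<Sum>t = l..<N. (\<gamma> t powr r) *\<^sub>R SA_iterate X \<Phi> \<gamma> x0 \<xi> t \<omega>) /\<^sub>R
     (\<Sum>t = l..<N. \<gamma> t powr r)"

definition window_start :: "real \<Rightarrow> nat \<Rightarrow> nat" where
  "window_start lam N = nat \<lceil>lam * real N\<rceil>"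

definition stepsize :: "real \<Rightarrow> real \<Rightarrow> real \<Rightarrow> nat \<Rightarrow> real" where
  "stepsize M C r k = 2 * M * sqrt (1 + of_bool (r < 1)) / (C * sqrt (real k + 1))"

definition TUB :: "real \<Rightarrow> real \<Rightarrow> real \<Rightarrow> real \<Rightarrow> nat \<Rightarrow> real" where
  "TUB M C r lam N =
     (let \<gamma> = stepsize M C r; l = window_start lam N in
       1 / (\<Sum>k = l..<N. \<gamma> k powr r) *
       (4 * M\<^sup>2 * (\<gamma> l powr (r - 1) + \<gamma> (N - 1) powr (r - 1) * of_bool (r < 1))
        + C\<^sup>2 * (\<Sum>k = l..<N. \<gamma> k powr (r + 1))))"

text \<open>A Landau bound stated for all indices N satisfying Q, with a single constant;
  it implies the bound along \<open>sequentially\<close> whenever Q holds eventually. Integrability is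
  part of the assertion because the library's expectation of a non-integrable function is 0.\<close>

definition expectation_bigo_on ::
  "'w measure \<Rightarrow> (nat \<Rightarrow> bool) \<Rightarrow> (nat \<Rightarrow> 'w \<Rightarrow> real) \<Rightarrow> (nat \<Rightarrow> real) \<Rightarrow> bool" where
  "expectation_bigo_on P Q Z g \<longleftrightarrow>
     (\<forall>N. Q N \<longrightarrow> integrable P (Z N)) \<and>
     (\<lambda>N. prob_space.expectation P (Z N)) \<in> O[principal {N. Q N}](g)"

end

theory Submission
  imports Defs
begin

text \<open>Write \<open>w\<^sub>t = \<Phi>(x\<^sub>t, \<xi>\<^sub>t) - F(x\<^sub>t)\<close>. Nonexpansiveness of the projection and monotonicity of \<open>F\<close>
  give, for every \<open>y \<in> X\<close>,
  \<open>\<gamma>\<^sub>t\<^sup>r F(y)\<^sup>T(x\<^sub>t - y) \<le> (\<gamma>\<^sub>t\<^sup>r\<^sup>-\<^sup>1 / 2) (\<parallel>x\<^sub>t - y\<parallel>\<^sup>2 - \<parallel>x\<^sub>t\<^sub>+\<^sub>1 - y\<parallel>\<^sup>2) + (\<gamma>\<^sub>t\<^sup>r\<^sup>+\<^sup>1 / 2) \<parallel>\<Phi>(x\<^sub>t, \<xi>\<^sub>t)\<parallel>\<^sup>2 - \<gamma>\<^sub>t\<^sup>r w\<^sub>t\<^sup>T(x\<^sub>t - y)\<close>.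
  Since \<open>\<gamma>\<^sub>t\<^sup>r\<^sup>-\<^sup>1\<close> is nondecreasing, summation by parts bounds the first terms by
  \<open>2 M\<^sup>2 \<gamma>\<^sub>N\<^sub>-\<^sub>1\<^sup>r\<^sup>-\<^sup>1\<close>. The supremum over \<open>y\<close> of the noise term is at most \<open>M \<parallel>\<Sum> \<gamma>\<^sub>t\<^sup>r w\<^sub>t\<parallel>\<close>
  plus a term of mean zero, and the \<open>w\<^sub>t\<close> are orthogonal in mean square. On the window \<open>\<lambda>N \<le> t + 1 \<le> N\<close> all stepsizes
  are of order \<open>1 / \<surd>N\<close>, whence (a) and (b). For (c), \<open>TUB(r, \<lambda>, N)\<close> is at most \<open>K / \<surd>N\<close> uniformly
  in \<open>\<lambda> \<le> 1/2\<close>, while \<open>TUB(1, \<lambda>, N)\<close> is at least of order \<open>ln (1 / \<lambda>) / \<surd>N\<close>.\<close>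

section \<open>Power sums and the bound TUB\<close>

text \<open>Scaling: \<open>x = u * y\<close> with \<open>u\<close> between \<open>mu\<close> and 1,
  so \<open>u powr p\<close> lies between 1 and \<open>mu powr p\<close>, in an order given by the
  sign of \<open>p\<close>. Minimum and maximum cover both signs, since \<open>r\<close> may be any
  real up to 1.\<close>

lemma powr_window_bounds:
  fixes mu x y p :: real
  assumes "0 < mu" "mu < 1" "0 < y" "mu * y \<le> x" "x \<le> y"
  shows "min 1 (mu powr p) * y powr p \<le> x powr p" "x powr p \<le> max 1 (mu powr p) * y powr p"
proof -
  define u where "u = x / y"
  have u: "mu \<le> u" "u \<le> 1" and x: "x = u * y" using assms by (auto simp: u_def field_simps)
  have xp: "x powr p = u powr p * y powr p"
    using u assms by (simp add: x powr_mult)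
  have "min 1 (mu powr p) \<le> u powr p \<and> u powr p \<le> max 1 (mu powr p)"
  proof (cases "0 \<le> p")
    case True
    then have "mu powr p \<le> u powr p" "u powr p \<le> 1 powr p"
      using u assms by (intro powr_mono2; simp)+
    then show ?thesis by simp
  next
    case False
    then have "u powr p \<le> mu powr p" "1 powr p \<le> u powr p"
      using u assms by (intro powr_mono2'; simp)+
    then show ?thesis by simp
  qed
  then show "min 1 (mu powr p) * y powr p \<le> x powr p" "x powr p \<le> max 1 (mu powr p) * y powr p"
    unfolding xp by (auto intro: mult_right_mono)
qed

text \<open>There are at most \<open>N\<close> terms, each comparable to
  \<open>real N powr p\<close> because the window stays above \<open>mu * real N\<close>. This works
  for every \<open>p\<close>, including -1, at the price of a constant that depends on
  \<open>mu\<close>.\<close>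

lemma sum_powr_window_le:
  fixes mu p :: real
  assumes "0 < mu" "mu < 1"
  obtains K where "K > 0"
    "\<And>N l. mu * real N \<le> real l \<Longrightarrow> (\<Sum>k = l..<N. (real k + 1) powr p) \<le> K * real N powr (p + 1)"
proof
  let ?K = "max 1 (mu powr p)"
  show "?K > 0" by simp
  show "(\<Sum>k = l..<N. (real k + 1) powr p) \<le> ?K * real N powr (p + 1)" if "mu * real N \<le> real l" for N l
  proof (cases "l < N")
    case True
    then have N: "0 < real N" by simp
    have "(\<Sum>k = l..<N. (real k + 1) powr p) \<le> (\<Sum>k = l..<N. ?K * real N powr p)"
      using that by (intro sum_mono powr_window_bounds(2) assms N) auto
    also have "\<dots> = real (N - l) * (?K * real N powr p)" by simp
    also have "\<dots> \<le> real N * (?K * real N powr p)"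
      by (intro mult_right_mono) auto
    also have "\<dots> = ?K * real N powr (p + 1)" using N by (simp add: powr_add)
    finally show ?thesis .
  qed simp
qed

lemma window_start_bounds:
  assumes "0 < lam"
  shows "lam * real N \<le> real (window_start lam N)" "real (window_start lam N) < lam * real N + 1"
proof -
  have "real (window_start lam N) = of_int \<lceil>lam * real N\<rceil>"
    using assms by (simp add: window_start_def)
  then show "lam * real N \<le> real (window_start lam N)" "real (window_start lam N) < lam * real N + 1"
    using ceiling_correct[of "lam * real N"] by linarith+
qed

text \<open>Only the indices from \<open>window_start mu N\<close> on are kept: at least
  \<open>(1 - mu) / 2 * real N\<close> of them, with terms comparable to
  \<open>real N powr p\<close>. The constant does not depend on \<open>l\<close>, so it also serves
  all windows that start earlier.\<close>

lemma sum_powr_window_ge: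
  fixes mu p :: real
  assumes "0 < mu" "mu < 1"
  obtains c where "c > 0"
    "\<And>N l. \<lbrakk>real l < mu * real N + 1; real N > 2 / (1 - mu)\<rbrakk>
      \<Longrightarrow> c * real N powr (p + 1) \<le> (\<Sum>k = l..<N. (real k + 1) powr p)"
proof
  let ?c = "min 1 (mu powr p)"
  show "(1 - mu) / 2 * ?c > 0" using assms by simp
  show "(1 - mu) / 2 * ?c * real N powr (p + 1) \<le> (\<Sum>k = l..<N. (real k + 1) powr p)"
    if l: "real l < mu * real N + 1" and N2: "real N > 2 / (1 - mu)" for N l
  proof -
    define m where "m = window_start mu N"
    have N: "0 < real N" using N2 assms by (smt (verit) divide_pos_pos)
    have m: "mu * real N \<le> real m" "real m < mu * real N + 1"
      unfolding m_def by (rule window_start_bounds[OF assms(1)])+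
    have "l \<le> m" using l m(1) by linarith
    have "2 < (1 - mu) * real N" using N2 assms by (simp add: field_simps)
    then have cnt: "(1 - mu) / 2 * real N \<le> real N - real m" "m \<le> N"
    proof -
      \<comment> \<open>The ceiling costs less than one index, and \<open>2 < d\<close> makes
        \<open>d - 1\<close> at least \<open>d / 2\<close>.\<close>
      define d where "d = (1 - mu) * real N"
      have "2 < d" "real m < real N - d + 1"
        using \<open>2 < (1 - mu) * real N\<close> m(2) by (simp_all add: d_def algebra_simps)
      then have "d / 2 \<le> real N - real m" "real m \<le> real N" by linarith+
      then show "(1 - mu) / 2 * real N \<le> real N - real m" "m \<le> N" by (simp_all add: d_def)
    qed
    have "(1 - mu) / 2 * ?c * real N powr (p + 1) = (1 - mu) / 2 * real N * (?c * real N powr p)"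
      using N by (simp add: powr_add)
    also have "\<dots> \<le> (real N - real m) * (?c * real N powr p)"
      using cnt(1) by (rule mult_right_mono) simp
    also have "\<dots> = (\<Sum>k = m..<N. ?c * real N powr p)" using cnt(2) by (simp add: of_nat_diff)
    also have "\<dots> \<le> (\<Sum>k = m..<N. (real k + 1) powr p)"
      using m by (intro sum_mono powr_window_bounds(1) assms N) auto
    also have "\<dots> \<le> (\<Sum>k = l..<N. (real k + 1) powr p)"
      using \<open>l \<le> m\<close> by (intro sum_mono2) auto
    finally show ?thesis .
  qed
qed

text \<open>Mean value theorem for the power \<open>p + 1\<close>, whose derivative is nonincreasing
  for \<open>p \<le> 0\<close> and hence smallest at the right end.\<close>

lemma powr_telescope_step:
  fixes p :: real
  assumes "-1 < p" "p \<le> 0"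
  shows "(p + 1) * (real k + 1) powr p \<le> (real k + 1) powr (p + 1) - real k powr (p + 1)"
proof (cases "k = 0")
  \<comment> \<open>The power need not be differentiable at 0, so \<open>MVT2\<close> cannot be used
    on the first interval.\<close>
  case True
  then show ?thesis using assms by simp
next
  case False
  have "\<exists>z. real k < z \<and> z < real k + 1 \<and>
     (real k + 1) powr (p + 1) - real k powr (p + 1) = (real k + 1 - real k) * ((p + 1) * z powr p)"
    using False by (intro MVT2) (auto intro!: derivative_eq_intros)
  then obtain z where z: "real k < z" "z < real k + 1"
    and eq: "(real k + 1) powr (p + 1) - real k powr (p + 1) = (p + 1) * z powr p" by auto
  have "(real k + 1) powr p \<le> z powr p" using z assms False by (intro powr_mono2') auto
  then show ?thesis unfolding eq using assms by (intro mult_left_mono) auto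
qed

text \<open>Telescoping gives the factor \<open>1 / (p + 1)\<close> for nonpositive
  \<open>p\<close>; bounding each term by \<open>real N powr p\<close> gives the factor 1 for
  positive \<open>p\<close>. Unlike in \<open>sum_powr_window_le\<close>, the constant is
  independent of where the window starts, as the comparison of \<open>TUB\<close> values for all
  small lambda requires.\<close>

lemma sum_powr_le:
  fixes p :: real
  assumes "-1 < p"
  shows "(\<Sum>k = l..<N. (real k + 1) powr p) \<le> max 1 (1 / (p + 1)) * real N powr (p + 1)"
proof (cases "N = 0")
  case False
  have "(\<Sum>k = l..<N. (real k + 1) powr p) \<le> (\<Sum>k = 0..<N. (real k + 1) powr p)"
    by (intro sum_mono2) auto
  also have "\<dots> \<le> max 1 (1 / (p + 1)) * real N powr (p + 1)"
  proof (cases "p \<le> 0")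
    case True
    have "(\<Sum>k = 0..<N. (real k + 1) powr p)
      \<le> (\<Sum>k = 0..<N. 1 / (p + 1) * (real (Suc k) powr (p + 1) - real k powr (p + 1)))"
      using powr_telescope_step[OF assms True] assms
      by (intro sum_mono) (simp add: field_simps)
    also have "\<dots> = 1 / (p + 1) * real N powr (p + 1)"
      using sum_Suc_diff'[of 0 N "\<lambda>k. real k powr (p + 1)"] assms
      by (simp only: sum_distrib_left[symmetric]) simp
    also have "\<dots> \<le> max 1 (1 / (p + 1)) * real N powr (p + 1)"
      by (intro mult_right_mono) auto
    finally show ?thesis .
  next
    case False
    have "(\<Sum>k = 0..<N. (real k + 1) powr p) \<le> (\<Sum>k = 0..<N. real N powr p)"
      using False by (intro sum_mono powr_mono2) auto
    also have "\<dots> = 1 * real N powr (p + 1)" using \<open>N \<noteq> 0\<close> by (simp add: powr_add)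
    also have "\<dots> \<le> max 1 (1 / (p + 1)) * real N powr (p + 1)"
      by (intro mult_right_mono) auto
    finally show ?thesis .
  qed
  finally show ?thesis .
qed simp

text \<open>The logarithm telescopes, and \<open>ln (1 + u) \<le> u\<close> at
  \<open>u = 1 / (k + 1)\<close> bounds each difference. This logarithm makes \<open>TUB\<close> at
  r = 1 large for small lambda.\<close>

lemma ln_le_harmonic_sum:
  assumes "l \<le> N"
  shows "ln ((real N + 1) / (real l + 1)) \<le> (\<Sum>k = l..<N. 1 / (real k + 1))"
proof -
  have "ln ((real N + 1) / (real l + 1)) = ln (real N + 1) - ln (real l + 1)"
    by (simp add: ln_div)
  also have "\<dots> = (\<Sum>k = l..<N. ln (real (Suc k) + 1) - ln (real k + 1))"
    using sum_Suc_diff'[OF assms, of "\<lambda>k. ln (real k + 1)"] by simp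
  also have "\<dots> \<le> (\<Sum>k = l..<N. 1 / (real k + 1))"
  proof (intro sum_mono)
    fix k
    have "ln (real (Suc k) + 1) - ln (real k + 1) = ln ((real k + 2) / (real k + 1))"
      by (simp add: ln_div add.commute)
    also have "(real k + 2) / (real k + 1) = 1 + 1 / (real k + 1)" by (simp add: field_simps)
    also have "ln \<dots> \<le> 1 / (real k + 1)" by (rule ln_add_one_self_le_self) simp
    finally show "ln (real (Suc k) + 1) - ln (real k + 1) \<le> 1 / (real k + 1)" .
  qed
  finally show ?thesis .
qed

section \<open>Upper and lower estimates of \<open>TUB\<close> and their comparison\<close>

lemma stepsize_pos: "\<lbrakk>M > 0; C > 0\<rbrakk> \<Longrightarrow> stepsize M C r k > 0"
  by (simp add: stepsize_def add_pos_nonneg)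

text \<open>Separates the constant from the index, so that all sums over stepsizes become power sums
  of \<open>k + 1\<close>.\<close>

lemma stepsize_powr:
  assumes "M > 0" "C > 0"
  shows "stepsize M C r k powr p = stepsize M C r 0 powr p * (real k + 1) powr (- p / 2)"
proof -
  have "stepsize M C r k = stepsize M C r 0 * (real k + 1) powr (- (1 / 2))"
    by (simp add: stepsize_def powr_minus powr_half_sqrt divide_simps)
  then show ?thesis
    using stepsize_pos[OF assms, of r 0] by (simp add: powr_mult powr_powr)
qed

text \<open>Uniformity in \<open>lam\<close> is the point. The numerator has order at most
  \<open>(1 - r) / 2\<close> in \<open>N\<close> for every window; the denominator has order at
  least \<open>1 - r / 2\<close>, because for \<open>lam \<le> 1 / 2\<close> the window contains
  about the upper half of the indices. The bound 4 on \<open>N\<close> is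
  \<open>2 / (1 - mu)\<close> at \<open>mu = 1 / 2\<close>.\<close>

lemma TUB_le_inverse_sqrt:
  assumes "M > 0" "C > 0" "r < 1"
  obtains K where "K > 0"
    "\<And>lam N. \<lbrakk>0 < lam; lam \<le> 1 / 2; N > 4\<rbrakk> \<Longrightarrow> TUB M C r lam N \<le> K * real N powr (- 1 / 2)"
proof -
  define a where "a = stepsize M C r 0"
  have a: "a > 0" unfolding a_def by (rule stepsize_pos[OF assms(1,2)])
  obtain c where c: "c > 0" and cbound: "\<And>N l. \<lbrakk>real l < 1 / 2 * real N + 1; real N > 2 / (1 - 1 / 2)\<rbrakk>
      \<Longrightarrow> c * real N powr (- r / 2 + 1) \<le> (\<Sum>k = l..<N. (real k + 1) powr (- r / 2))"
    by (rule sum_powr_window_ge[of "1 / 2" "- r / 2"]) auto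
  \<comment> \<open>Here \<open>r < 1\<close> is decisive: it puts the exponent above -1, whereas at
    r = 1 the sum is harmonic.\<close>
  define L where "L = max 1 (1 / (- (r + 1) / 2 + 1))"
  have Lbound: "(\<Sum>k = l..<N. (real k + 1) powr (- (r + 1) / 2)) \<le> L * real N powr (- (r + 1) / 2 + 1)" for l N
    unfolding L_def using assms by (intro sum_powr_le) simp
  have "L > 0" by (simp add: L_def)
  define D where "D = 4 * M\<^sup>2 * (2 * a powr (r - 1)) + C\<^sup>2 * (a powr (r + 1) * L)"
  have "D > 0" unfolding D_def using a assms \<open>L > 0\<close> by (intro add_pos_pos mult_pos_pos) auto
  show thesis
  proof
    show "D / (a powr r * c) > 0" using \<open>D > 0\<close> a c by simp
    fix lam :: real and N :: nat
    assume lam: "0 < lam" "lam \<le> 1 / 2" and N: "N > 4"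
    define l where "l = window_start lam N"
    have "lam * real N \<le> 1 / 2 * real N" using lam by (intro mult_right_mono) auto
    then have l: "real l < 1 / 2 * real N + 1" using window_start_bounds[OF lam(1), of N] by (simp add: l_def)
    let ?g = "stepsize M C r" and ?n = "real N powr ((1 - r) / 2)"
    have g: "?g k powr p = a powr p * (real k + 1) powr (- p / 2)" for k p
      unfolding a_def by (rule stepsize_powr[OF assms(1,2)])
    \<comment> \<open>The exponent is nonnegative, and \<open>l + 1 \<le> N\<close> because
      \<open>l < N / 2 + 1\<close> and \<open>N > 4\<close>.\<close>
    have "(real l + 1) powr (- (r - 1) / 2) \<le> real N powr (- (r - 1) / 2)"
      using l N assms by (intro powr_mono2) auto
    then have 1: "?g l powr (r - 1) \<le> a powr (r - 1) * ?n"
      unfolding g by (intro mult_left_mono) auto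
    have 2: "?g (N - 1) powr (r - 1) = a powr (r - 1) * ?n"
      unfolding g using N by (simp add: of_nat_diff)
    have e: "- (r + 1) / 2 + 1 = (1 - r) / 2" by (simp add: field_simps)
    have "(\<Sum>k = l..<N. ?g k powr (r + 1)) = a powr (r + 1) * (\<Sum>k = l..<N. (real k + 1) powr (- (r + 1) / 2))"
      unfolding g by (rule sum_distrib_left[symmetric])
    also have "\<dots> \<le> a powr (r + 1) * (L * ?n)"
      using Lbound[of l N] unfolding e by (intro mult_left_mono) auto
    finally have 3: "(\<Sum>k = l..<N. ?g k powr (r + 1)) \<le> a powr (r + 1) * (L * ?n)" .
    have "c * real N powr (- r / 2 + 1) \<le> (\<Sum>k = l..<N. (real k + 1) powr (- r / 2))"
      using l N by (intro cbound) auto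
    then have "a powr r * (c * real N powr (- r / 2 + 1)) \<le> a powr r * (\<Sum>k = l..<N. (real k + 1) powr (- r / 2))"
      by (rule mult_left_mono) simp
    then have 4: "a powr r * (c * real N powr (- r / 2 + 1)) \<le> (\<Sum>k = l..<N. ?g k powr r)"
      unfolding g by (simp only: sum_distrib_left)
    have pos: "0 < a powr r * (c * real N powr (- r / 2 + 1))" using a c N by simp
    have "4 * M\<^sup>2 * (?g l powr (r - 1) + ?g (N - 1) powr (r - 1)) + C\<^sup>2 * (\<Sum>k = l..<N. ?g k powr (r + 1))
      \<le> 4 * M\<^sup>2 * (a powr (r - 1) * ?n + a powr (r - 1) * ?n) + C\<^sup>2 * (a powr (r + 1) * (L * ?n))"
      using 1 2 3 by (intro add_mono mult_left_mono) auto
    also have "\<dots> = D * ?n" by (simp add: D_def algebra_simps)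
    finally have num: "4 * M\<^sup>2 * (?g l powr (r - 1) + ?g (N - 1) powr (r - 1))
        + C\<^sup>2 * (\<Sum>k = l..<N. ?g k powr (r + 1)) \<le> D * ?n" .
    have "TUB M C r lam N = (4 * M\<^sup>2 * (?g l powr (r - 1) + ?g (N - 1) powr (r - 1))
        + C\<^sup>2 * (\<Sum>k = l..<N. ?g k powr (r + 1))) / (\<Sum>k = l..<N. ?g k powr r)"
      using assms by (simp add: TUB_def Let_def l_def)
    also have "\<dots> \<le> D * ?n / (a powr r * (c * real N powr (- r / 2 + 1)))"
      using num 4 pos \<open>D > 0\<close> by (intro frac_le) auto
    also have "\<dots> = D / (a powr r * c) * (?n / real N powr (- r / 2 + 1))" by simp
    also have "?n / real N powr (- r / 2 + 1) = real N powr ((1 - r) / 2 - (- r / 2 + 1))"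
      by (rule powr_diff[symmetric])
    also have "(1 - r) / 2 - (- r / 2 + 1) = - 1 / 2" by (simp add: field_simps)
    finally show "TUB M C r lam N \<le> D / (a powr r * c) * real N powr (- 1 / 2)" .
  qed
qed

text \<open>At r = 1 the squared stepsizes form a harmonic sum, so the numerator carries a
  logarithm, while the denominator is at most \<open>2 * a * sqrt N\<close>.\<close>

lemma TUB_one_ge:
  assumes "M > 0" "C > 0" and l: "window_start lam N < N"
  shows "M * C * ln ((real N + 1) / (real (window_start lam N) + 1)) * real N powr (- 1 / 2) \<le> TUB M C 1 lam N"
proof -
  define l where "l = window_start lam N"
  define a where "a = stepsize M C 1 0"
  have a: "a = 2 * M / C" by (simp add: a_def stepsize_def)
  have "a > 0" using assms by (simp add: a)
  let ?g = "stepsize M C 1" and ?H = "\<Sum>k = l..<N. 1 / (real k + 1)"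
  have g: "?g k powr p = a powr p * (real k + 1) powr (- p / 2)" for k p
    unfolding a_def by (rule stepsize_powr[OF assms(1,2)])
  have H: "ln ((real N + 1) / (real l + 1)) \<le> ?H"
    using l by (intro ln_le_harmonic_sum) (simp add: l_def)
  have "?H \<ge> 0" by (intro sum_nonneg) auto
  have 1: "(\<Sum>k = l..<N. ?g k powr (1 + 1)) = a\<^sup>2 * ?H"
  proof -
    have "?g k powr (1 + 1) = a\<^sup>2 * (1 / (real k + 1))" for k
      unfolding g using \<open>a > 0\<close> powr_minus_divide[of "real k + 1" 1] by simp
    then show ?thesis by (simp only: sum_distrib_left)
  qed
  have "(\<Sum>k = l..<N. ?g k powr 1) = a * (\<Sum>k = l..<N. (real k + 1) powr (- 1 / 2))"
    unfolding g sum_distrib_left using \<open>a > 0\<close> by simp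
  also have "\<dots> \<le> a * (2 * real N powr (1 / 2))"
    using sum_powr_le[of "- 1 / 2" l N] \<open>a > 0\<close> by (intro mult_left_mono) auto
  finally have 2: "(\<Sum>k = l..<N. ?g k powr 1) \<le> a * (2 * real N powr (1 / 2))" .
  have 3: "0 < (\<Sum>k = l..<N. ?g k powr 1)"
    using l stepsize_pos[OF assms(1,2), of 1] by (intro sum_pos) (auto simp: l_def order_less_imp_not_eq2)
  have "M * C * ln ((real N + 1) / (real l + 1)) * real N powr (- 1 / 2) \<le> M * C * ?H * real N powr (- 1 / 2)"
    using H assms by (intro mult_right_mono mult_left_mono) auto
  \<comment> \<open>From \<open>a = 2 * M / C\<close> comes
    \<open>C\<^sup>2 * a / 2 = M * C\<close>.\<close>
  also have "\<dots> = C\<^sup>2 * (a\<^sup>2 * ?H) / (a * (2 * real N powr (1 / 2)))"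
    using assms l by (simp add: a powr_minus field_simps power2_eq_square)
  also have "\<dots> \<le> (4 * M\<^sup>2 * ?g l powr (1 - 1) + C\<^sup>2 * (\<Sum>k = l..<N. ?g k powr (1 + 1))) / (\<Sum>k = l..<N. ?g k powr 1)"
    unfolding 1 using 2 3 \<open>?H \<ge> 0\<close> by (intro frac_le) auto
  also have "\<dots> = TUB M C 1 lam N" by (simp add: TUB_def Let_def l_def)
  finally show ?thesis by (simp add: l_def)
qed

lemma TUB_comparison:
  assumes "M > 0" "C > 0" "r < 1"
  shows "\<exists>lam\<^sub>0 N\<^sub>0. 0 < lam\<^sub>0 \<and> lam\<^sub>0 < 1 \<and> N\<^sub>0 \<ge> 1 \<and>
       (\<forall>lam N. 0 < lam \<and> lam < lam\<^sub>0 \<and> N > N\<^sub>0 \<longrightarrow> TUB M C r lam N \<le> TUB M C 1 lam N)"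
proof -
  obtain K where K: "K > 0"
    "\<And>lam N. \<lbrakk>0 < lam; lam \<le> 1 / 2; N > 4\<rbrakk> \<Longrightarrow> TUB M C r lam N \<le> K * real N powr (- 1 / 2)"
    using TUB_le_inverse_sqrt[OF assms] by blast
  \<comment> \<open>Chosen so that \<open>M * C * ln (1 / (2 * lam\<^sub>0)) = K\<close>: the
    logarithm at r = 1 then reaches the constant for \<open>r < 1\<close>.\<close>
  define lam\<^sub>0 where "lam\<^sub>0 = exp (- K / (M * C)) / 2"
  have lam0: "0 < lam\<^sub>0" "lam\<^sub>0 < 1 / 2" using assms K(1) by (simp_all add: lam\<^sub>0_def)
  \<comment> \<open>\<open>N \<ge> 2 / lam\<^sub>0\<close> absorbs the rounding in
    \<open>l + 1 < lam * N + 2\<close>, giving \<open>l + 1 \<le> 2 * lam\<^sub>0 * N\<close>. The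
    summand 4 secures the condition \<open>N > 4\<close> attached to \<open>K\<close>.\<close>
  define N\<^sub>0 where "N\<^sub>0 = nat \<lceil>2 / lam\<^sub>0\<rceil> + 4"
  have "TUB M C r lam N \<le> TUB M C 1 lam N" if lam: "0 < lam" "lam < lam\<^sub>0" and N: "N > N\<^sub>0" for lam N
  proof -
    have "2 / lam\<^sub>0 \<le> real (nat \<lceil>2 / lam\<^sub>0\<rceil>)" by (rule real_nat_ceiling_ge)
    also have "\<dots> \<le> real N" using N unfolding N\<^sub>0_def by linarith
    finally have N2: "2 \<le> lam\<^sub>0 * real N" using lam0 by (simp add: field_simps)
    have "N > 4" using N by (simp add: N\<^sub>0_def)
    define l where "l = window_start lam N"
    have "lam * real N \<le> lam\<^sub>0 * real N" "lam\<^sub>0 * real N \<le> 1 / 2 * real N"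
      using lam lam0 by (intro mult_right_mono; simp)+
    moreover have "real l < lam * real N + 1"
      unfolding l_def by (rule window_start_bounds[OF lam(1)])
    ultimately have l: "real l + 1 \<le> 2 * (lam\<^sub>0 * real N)" "real l < real N"
      using N2 \<open>N > 4\<close> by linarith+
    have "exp (K / (M * C)) = 1 / (2 * lam\<^sub>0)" by (simp add: lam\<^sub>0_def exp_minus field_simps)
    also have "\<dots> \<le> (real N + 1) / (real l + 1)"
    proof -
      have "real l + 1 \<le> (real N + 1) * (2 * lam\<^sub>0)" using l(1) lam0 by (simp add: algebra_simps)
      then show ?thesis using lam0 by (simp add: field_simps)
    qed
    finally have "ln (exp (K / (M * C))) \<le> ln ((real N + 1) / (real l + 1))"
      by (subst ln_le_cancel_iff) auto
    then have "K \<le> M * C * ln ((real N + 1) / (real l + 1))"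
      using assms by (simp add: field_simps)
    then have "K * real N powr (- 1 / 2) \<le> M * C * ln ((real N + 1) / (real l + 1)) * real N powr (- 1 / 2)"
      by (rule mult_right_mono) simp
    also have "\<dots> \<le> TUB M C 1 lam N"
      unfolding l_def using l(2) by (intro TUB_one_ge assms) (simp add: l_def)
    finally show ?thesis using K(2)[of lam N] lam lam0 \<open>N > 4\<close> by simp
  qed
  moreover have "N\<^sub>0 \<ge> 1" by (simp add: N\<^sub>0_def)
  ultimately show ?thesis using lam0 by (intro exI[of _ lam\<^sub>0] exI[of _ N\<^sub>0]) auto
qed

section \<open>Independence of past and present noise\<close>

text \<open>Independence is the product rule on rectangles, and rectangles determine the product of
  sigma-finite measures.\<close>

lemma (in prob_space) distr_pair_indep_random_variables:
  assumes "indep_random_variables M S U T V"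
  shows "distr M (S \<Otimes>\<^sub>M T) (\<lambda>\<omega>. (U \<omega>, V \<omega>)) = distr M S U \<Otimes>\<^sub>M distr M T V"
proof -
  have U[measurable]: "U \<in> measurable M S" and V[measurable]: "V \<in> measurable M T"
    and ind: "indep_set (sigma_sets (space M) {U -` A \<inter> space M | A. A \<in> sets S})
      (sigma_sets (space M) {V -` A \<inter> space M | A. A \<in> sets T})"
    using assms by (auto simp: indep_random_variables_def)
  interpret U: prob_space "distr M S U" by (rule prob_space_distr) fact
  interpret V: prob_space "distr M T V" by (rule prob_space_distr) fact
  show ?thesis
  proof (rule pair_measure_eqI[symmetric])
    fix A B assume A: "A \<in> sets (distr M S U)" and B: "B \<in> sets (distr M T V)"
    then have [measurable]: "A \<in> sets S" "B \<in> sets T" by auto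
    have "prob ((U -` A \<inter> space M) \<inter> (V -` B \<inter> space M))
      = prob (U -` A \<inter> space M) * prob (V -` B \<inter> space M)"
      using A B by (intro indep_setD[OF ind] sigma_sets.Basic) auto
    moreover have "(\<lambda>\<omega>. (U \<omega>, V \<omega>)) -` (A \<times> B) \<inter> space M = (U -` A \<inter> space M) \<inter> (V -` B \<inter> space M)"
      by auto
    ultimately show "emeasure (distr M S U) A * emeasure (distr M T V) B
      = emeasure (distr M (S \<Otimes>\<^sub>M T) (\<lambda>\<omega>. (U \<omega>, V \<omega>))) (A \<times> B)"
      by (simp add: emeasure_distr emeasure_eq_measure ennreal_mult')
  qed (auto intro: U.sigma_finite_measure V.sigma_finite_measure cong: sets_pair_measure_cong)
qed

text \<open>Replaces conditioning on \<open>U\<close>: the value of \<open>U\<close> is frozen and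
  only the noise is integrated. The copy \<open>V'\<close> has its own integration variable, so
  equality of laws is all that links it to \<open>V\<close>.\<close>

lemma (in prob_space) nn_integral_indep_random_variables:
  assumes ind: "indep_random_variables M S U T V"
    and V': "V' \<in> measurable M T" "distr M T V = distr M T V'"
    and f: "f \<in> borel_measurable (S \<Otimes>\<^sub>M T)"
  shows "(\<integral>\<^sup>+\<omega>. f (U \<omega>, V \<omega>) \<partial>M) = (\<integral>\<^sup>+\<omega>. \<integral>\<^sup>+\<omega>'. f (U \<omega>, V' \<omega>') \<partial>M \<partial>M)"
proof -
  have U[measurable]: "U \<in> measurable M S" and V[measurable]: "V \<in> measurable M T"
    using ind by (auto simp: indep_random_variables_def)
  note f[measurable] V'(1)[measurable]
  interpret V: prob_space "distr M T V'" by (rule prob_space_distr) fact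
  have "(\<integral>\<^sup>+\<omega>. f (U \<omega>, V \<omega>) \<partial>M) = integral\<^sup>N (distr M (S \<Otimes>\<^sub>M T) (\<lambda>\<omega>. (U \<omega>, V \<omega>))) f"
    by (simp add: nn_integral_distr)
  also have "\<dots> = integral\<^sup>N (distr M S U \<Otimes>\<^sub>M distr M T V') f"
    by (simp only: distr_pair_indep_random_variables[OF ind] V'(2))
  also have "\<dots> = (\<integral>\<^sup>+x. \<integral>\<^sup>+y. f (x, y) \<partial>distr M T V' \<partial>distr M S U)"
    by (rule V.nn_integral_fst[symmetric]) simp
  also have "\<dots> = (\<integral>\<^sup>+\<omega>. \<integral>\<^sup>+y. f (U \<omega>, y) \<partial>distr M T V' \<partial>M)"
    by (intro nn_integral_distr) simp_all
  also have "\<dots> = (\<integral>\<^sup>+\<omega>. \<integral>\<^sup>+\<omega>'. f (U \<omega>, V' \<omega>') \<partial>M \<partial>M)"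
    using measurable_space[OF U] by (intro nn_integral_cong nn_integral_distr) simp_all
  finally show ?thesis .
qed

text \<open>Fubini in place of Tonelli, for integrands of varying sign such as products with the
  mean-zero noise.\<close>

lemma (in prob_space) expectation_indep_random_variables:
  fixes f :: "_ \<Rightarrow> 'c::{banach, second_countable_topology}"
  assumes ind: "indep_random_variables M S U T V"
    and V': "V' \<in> measurable M T" "distr M T V = distr M T V'"
    and f: "f \<in> borel_measurable (S \<Otimes>\<^sub>M T)"
    and int: "integrable M (\<lambda>\<omega>. f (U \<omega>, V \<omega>))"
  shows "expectation (\<lambda>\<omega>. f (U \<omega>, V \<omega>)) = expectation (\<lambda>\<omega>. expectation (\<lambda>\<omega>'. f (U \<omega>, V' \<omega>')))"
proof -
  have U[measurable]: "U \<in> measurable M S" and V[measurable]: "V \<in> measurable M T"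
    using ind by (auto simp: indep_random_variables_def)
  note f[measurable] V'(1)[measurable]
  interpret U: prob_space "distr M S U" by (rule prob_space_distr) fact
  interpret V: prob_space "distr M T V'" by (rule prob_space_distr) fact
  interpret pair_sigma_finite "distr M S U" "distr M T V'" ..
  have "integrable (distr M (S \<Otimes>\<^sub>M T) (\<lambda>\<omega>. (U \<omega>, V \<omega>))) f"
    using int by (subst integrable_distr_eq) simp_all
  then have intp: "integrable (distr M S U \<Otimes>\<^sub>M distr M T V') f"
    by (simp only: distr_pair_indep_random_variables[OF ind] V'(2))
  have "expectation (\<lambda>\<omega>. f (U \<omega>, V \<omega>)) = integral\<^sup>L (distr M (S \<Otimes>\<^sub>M T) (\<lambda>\<omega>. (U \<omega>, V \<omega>))) f"
    by (simp add: integral_distr)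
  also have "\<dots> = integral\<^sup>L (distr M S U \<Otimes>\<^sub>M distr M T V') f"
    by (simp only: distr_pair_indep_random_variables[OF ind] V'(2))
  also have "\<dots> = (\<integral>x. \<integral>y. f (x, y) \<partial>distr M T V' \<partial>distr M S U)"
    by (rule integral_fst'[symmetric]) fact
  also have "\<dots> = (\<integral>\<omega>. \<integral>y. f (U \<omega>, y) \<partial>distr M T V' \<partial>M)"
    by (intro integral_distr) simp_all
  also have "\<dots> = (\<integral>\<omega>. \<integral>\<omega>'. f (U \<omega>, V' \<omega>') \<partial>M \<partial>M)"
    using measurable_space[OF U] by (intro Bochner_Integration.integral_cong integral_distr) simp_all
  finally show ?thesis .
qed

section \<open>The natural filtration of the initial vector and the noise\<close>

definition generated_by ::
  "'w measure \<Rightarrow> ('w \<Rightarrow> 'a::topological_space) \<Rightarrow> (nat \<Rightarrow> 'w \<Rightarrow> 'b::topological_space) \<Rightarrow> nat option \<Rightarrow> 'w set set" where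
  "generated_by P U V i = (case i of None \<Rightarrow> {U -` A \<inter> space P | A. A \<in> sets borel}
     | Some j \<Rightarrow> {V j -` A \<inter> space P | A. A \<in> sets borel})"

text \<open>Time \<open>k\<close> sees the \<open>V j\<close> with \<open>j < k\<close> but not
  \<open>V k\<close>. Presenting the sigma-algebra by generating families lets
  \<open>indep_sets_collect_sigma\<close> act on blocks of indices.\<close>

definition history ::
  "'w measure \<Rightarrow> ('w \<Rightarrow> 'a::topological_space) \<Rightarrow> (nat \<Rightarrow> 'w \<Rightarrow> 'b::topological_space) \<Rightarrow> nat \<Rightarrow> 'w measure" where
  "history P U V k = sigma (space P) (\<Union>i\<in>insert None (Some ` {..<k}). generated_by P U V i)"

lemma generated_by_subset_Pow: "generated_by P U V i \<subseteq> Pow (space P)"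
  by (auto simp: generated_by_def split: option.splits)

lemma space_history [simp]: "space (history P U V k) = space P"
  by (auto simp: history_def space_measure_of_conv)

lemma sets_history:
  "sets (history P U V k) = sigma_sets (space P) (\<Union>i\<in>insert None (Some ` {..<k}). generated_by P U V i)"
  unfolding history_def using generated_by_subset_Pow by (intro sets_measure_of) blast

lemma measurable_initial_history: "U \<in> borel_measurable (history P U V k)"
  by (rule measurableI) (auto simp: sets_history generated_by_def intro!: sigma_sets.Basic)

lemma measurable_noise_history: "j < k \<Longrightarrow> V j \<in> borel_measurable (history P U V k)"
  by (rule measurableI) (auto simp: sets_history generated_by_def intro!: sigma_sets.Basic)

lemma sets_history_mono: "j \<le> k \<Longrightarrow> sets (history P U V j) \<subseteq> sets (history P U V k)"
  unfolding sets_history by (intro sigma_sets_mono') auto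

lemma sets_history_subset:
  assumes "U \<in> borel_measurable P" "\<And>j. V j \<in> borel_measurable P"
  shows "sets (history P U V k) \<subseteq> sets P"
  unfolding sets_history using assms
  by (intro sets.sigma_sets_subset) (auto simp: generated_by_def intro: measurable_sets)

text \<open>Indexing by \<open>nat option\<close>, with \<open>None\<close> for the initial vector, turns the two independence
  hypotheses into a single independent family, although the variables have different value types.\<close>

lemma (in prob_space) indep_sets_generated_by:
  assumes V: "indep_vars (\<lambda>_. borel) V UNIV"
    and UV: "indep_random_variables M borel U (Pi\<^sub>M UNIV (\<lambda>_. borel)) (\<lambda>\<omega> k. V k \<omega>)"
  shows "indep_sets (generated_by M U V) UNIV"
proof (rule indep_setsI)
  have U[measurable]: "U \<in> borel_measurable M" using UV by (simp add: indep_random_variables_def)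
  have Vm[measurable]: "V j \<in> borel_measurable M" for j using V by (simp add: indep_vars_def2)
  show "generated_by M U V i \<subseteq> events" for i
    by (auto simp: generated_by_def split: option.splits)
  have V': "indep_sets (\<lambda>j. generated_by M U V (Some j)) UNIV"
    using V by (simp add: indep_vars_def2 generated_by_def)
  have some: "prob (\<Inter>j\<in>J. A j) = (\<Prod>j\<in>J. prob (A j))"
    if "J \<noteq> {}" "finite J" "\<forall>j\<in>J. A j \<in> generated_by M U V (Some j)" for J A
    using that by (intro indep_setsD[OF V']) auto
  fix A J assume J: "J \<noteq> {}" "finite J" and A: "\<forall>j\<in>J. A j \<in> generated_by M U V j"
  define J' where "J' = {j. Some j \<in> J}"
  have J': "finite J'" "J - {None} = Some ` J'"
    using J(2) finite_vimageI[OF J(2), of Some]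
    by (auto simp: J'_def vimage_def image_iff) (metis not_None_eq)
  have A': "\<forall>j\<in>J'. A (Some j) \<in> generated_by M U V (Some j)" using A by (auto simp: J'_def)
  have J'_prod: "prob (\<Inter>j\<in>J'. A (Some j)) = (\<Prod>j\<in>J'. prob (A (Some j)))" if "J' \<noteq> {}"
    using some[OF that J'(1) A'] .
  show "prob (\<Inter>j\<in>J. A j) = (\<Prod>j\<in>J. prob (A j))"
  proof (cases "None \<in> J")
    case False
    then have "J = Some ` J'" using J' by auto
    then show ?thesis using J'_prod J(1) by (simp add: prod.reindex image_comp)
  next
    case True
    then have Jeq: "J = insert None (Some ` J')" using J' by auto
    show ?thesis
    proof (cases "J' = {}")
      case True
      then show ?thesis by (simp add: Jeq)
    next
      case False
      from A' obtain B where B: "\<And>j. j \<in> J' \<Longrightarrow> B j \<in> sets borel \<and> A (Some j) = V j -` B j \<inter> space M"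
        unfolding generated_by_def by simp metis
      \<comment> \<open>Finitely many noise events form one cylinder event of the whole sequence, to
        which the independence of \<open>U\<close> from the sequence applies.\<close>
      let ?B = "{v \<in> space (Pi\<^sub>M UNIV (\<lambda>_. borel)). \<forall>j\<in>J'. v j \<in> B j}"
      have "{v \<in> space (Pi\<^sub>M UNIV (\<lambda>_. borel)). v j \<in> B j} \<in> sets (Pi\<^sub>M UNIV (\<lambda>_. borel))" if "j \<in> J'" for j
        using B[OF that] by (intro measurable_sets_Collect[where N=borel, of "\<lambda>v. v j"]) auto
      then have Bm: "?B \<in> sets (Pi\<^sub>M UNIV (\<lambda>_. borel))"
        by (intro sets.sets_Collect_finite_All' J' False) auto
      have inter: "(\<Inter>j\<in>J'. A (Some j)) = (\<lambda>\<omega> k. V k \<omega>) -` ?B \<inter> space M"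
        using B False by (auto simp: space_PiM)
      have ind: "indep_set (sigma_sets (space M) {U -` A \<inter> space M | A. A \<in> sets borel})
        (sigma_sets (space M) {(\<lambda>\<omega> k. V k \<omega>) -` A \<inter> space M | A. A \<in> sets (Pi\<^sub>M UNIV (\<lambda>_. borel))})"
        using UV by (simp add: indep_random_variables_def)
      have "(\<Inter>j\<in>J'. A (Some j)) \<in> sigma_sets (space M)
          {(\<lambda>\<omega> k. V k \<omega>) -` A \<inter> space M | A. A \<in> sets (Pi\<^sub>M UNIV (\<lambda>_. borel))}"
        unfolding inter using Bm by (blast intro: sigma_sets.Basic)
      moreover have "A None \<in> generated_by M U V None" using A True by blast
      then have "A None \<in> sigma_sets (space M) {U -` A \<inter> space M | A. A \<in> sets borel}"
        by (auto simp: generated_by_def intro: sigma_sets.Basic)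
      ultimately have "prob (A None \<inter> (\<Inter>j\<in>J'. A (Some j))) = prob (A None) * prob (\<Inter>j\<in>J'. A (Some j))"
        by (intro indep_setD[OF ind])
      then show ?thesis
        using J'_prod[OF False] J'(1) by (simp add: Jeq prod.reindex image_comp)
    qed
  qed
qed

text \<open>The initial index together with the times before \<open>k\<close>, and the time
  \<open>k\<close> alone, are disjoint blocks. Their generators are closed under intersection, so
  the generated sigma-algebras are independent; those of \<open>H\<close> and \<open>V k\<close> are
  contained in them.\<close>

lemma (in prob_space) indep_history_noise:
  assumes V: "indep_vars (\<lambda>_. borel) V UNIV"
    and UV: "indep_random_variables M borel U (Pi\<^sub>M UNIV (\<lambda>_. borel)) (\<lambda>\<omega> k. V k \<omega>)"
    and H: "H \<in> measurable (history M U V k) S"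
  shows "indep_random_variables M S H borel (V k)"
proof -
  have U[measurable]: "U \<in> borel_measurable M" using UV by (simp add: indep_random_variables_def)
  have Vm[measurable]: "V j \<in> borel_measurable M" for j using V by (simp add: indep_vars_def2)
  let ?G = "generated_by M U V" and ?I = "case_bool (insert None (Some ` {..<k})) {Some k}"
  have Int: "Int_stable (?G i)" for i
  proof (cases i)
    case None
    then show ?thesis by (auto simp: Int_stable_def generated_by_def)
       (metis (no_types, lifting) sets.Int vimage_Int Int_assoc Int_left_commute Int_absorb)
  next
    case (Some j)
    then show ?thesis by (auto simp: Int_stable_def generated_by_def)
       (metis (no_types, lifting) sets.Int vimage_Int Int_assoc Int_left_commute Int_absorb)
  qed
  have "indep_sets (\<lambda>b. sigma_sets (space M) (\<Union>i\<in>?I b. ?G i)) UNIV"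
  proof (rule indep_sets_collect_sigma)
    show "indep_sets ?G (\<Union>b\<in>UNIV. ?I b)"
      by (rule indep_sets_mono_index[OF _ indep_sets_generated_by[OF V UV]]) simp
    show "disjoint_family_on ?I UNIV"
      by (auto simp: disjoint_family_on_def split: bool.splits)
  qed (rule Int)
  then have ind: "indep_sets (case_bool (sigma_sets (space M) {H -` A \<inter> space M | A. A \<in> sets S})
      (sigma_sets (space M) {V k -` A \<inter> space M | A. A \<in> sets borel})) UNIV"
  proof (rule indep_sets_mono_sets)
    fix b
    show "case_bool (sigma_sets (space M) {H -` A \<inter> space M | A. A \<in> sets S})
      (sigma_sets (space M) {V k -` A \<inter> space M | A. A \<in> sets borel}) b
      \<subseteq> sigma_sets (space M) (\<Union>i\<in>?I b. ?G i)"
    proof (cases b)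
      case True
      have "{H -` A \<inter> space M | A. A \<in> sets S} \<subseteq> sets (history M U V k)"
        using measurable_sets[OF H] by auto
      then have "sigma_sets (space M) {H -` A \<inter> space M | A. A \<in> sets S} \<subseteq> sets (history M U V k)"
        using sets.sigma_sets_subset[of _ "history M U V k"] by simp
      then show ?thesis using True by (simp add: sets_history)
    next
      case False
      then show ?thesis by (simp add: generated_by_def)
    qed
  qed
  moreover have "H \<in> measurable M S"
    using measurable_mono[OF order_refl refl sets_history_subset[of U M V k, OF U Vm], of S] H by auto
  ultimately show ?thesis
    by (simp add: indep_random_variables_def indep_set_def)
qed

section \<open>Expected gap of the averaged iterates\<close>

lemma bdd_above_gap_values:
  fixes X :: "'a::real_inner set"
  assumes "compact X" "continuous_on X F"
  shows "bdd_above ((\<lambda>y. F y \<bullet> (x - y)) ` X)"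
  using assms
  by (intro bounded_imp_bdd_above compact_imp_bounded compact_continuous_image continuous_intros)

text \<open>The gap is a supremum of affine functions with slopes \<open>F y\<close>, which are
  bounded on \<open>X\<close>. Its continuity supplies Borel measurability, which a supremum over an
  uncountable set does not give directly.\<close>

lemma gap_lipschitz:
  fixes X :: "'a::real_inner set"
  assumes "compact X" "X \<noteq> {}" "continuous_on X F"
  obtains B where "lipschitz_on B UNIV (gap X F)"
proof -
  have "bounded (F ` X)" using assms by (intro compact_imp_bounded compact_continuous_image)
  then obtain B where B: "B > 0" "\<And>y. y \<in> X \<Longrightarrow> norm (F y) \<le> B"
    by (auto simp: bounded_pos)
  note bdd = bdd_above_gap_values[OF assms(1,3)]
  have le: "gap X F x \<le> gap X F x' + B * dist x x'" for x x'
    unfolding gap_def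
  proof (rule cSUP_least[OF assms(2)])
    fix y assume y: "y \<in> X"
    have "F y \<bullet> (x - y) = F y \<bullet> (x' - y) + F y \<bullet> (x - x')"
      by (simp add: inner_diff_right)
    also have "F y \<bullet> (x - x') \<le> norm (F y) * norm (x - x')" by (rule norm_cauchy_schwarz)
    also have "\<dots> \<le> B * dist x x'" unfolding dist_norm using B(2)[OF y] by (rule mult_right_mono) simp
    also have "F y \<bullet> (x' - y) \<le> (SUP y\<in>X. F y \<bullet> (x' - y))"
      using y bdd by (rule cSUP_upper)
    finally show "F y \<bullet> (x - y) \<le> (SUP y\<in>X. F y \<bullet> (x' - y)) + B * dist x x'" by simp
  qed
  have "lipschitz_on B UNIV (gap X F)"
  proof (rule lipschitz_onI)
    fix x y
    show "dist (gap X F x) (gap X F y) \<le> B * dist x y"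
      using le[of x y] le[of y x] by (auto simp: dist_real_def dist_commute abs_le_iff)
  qed (use B in simp)
  then show thesis by (rule that)
qed

text \<open>Summation by parts: each increase of the weight multiplies some \<open>d t\<close>,
  which is at most \<open>D\<close>, so the increases add up to the last weight times
  \<open>D\<close>.\<close>

lemma sum_weighted_differences_le:
  fixes b d :: "nat \<Rightarrow> real"
  assumes "l < N" and mono: "\<And>t. b t \<le> b (Suc t)" and nonneg: "\<And>t. 0 \<le> b t"
    and d: "\<And>t. 0 \<le> d t" "\<And>t. d t \<le> D"
  shows "(\<Sum>t = l..<N. b t * (d t - d (Suc t))) \<le> b (N - 1) * D"
proof -
  \<comment> \<open>The induction keeps the nonnegative slack \<open>D - d (Suc n)\<close>; its
    weight may be raised to \<open>b (Suc n)\<close>, and the next difference then fits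
    exactly.\<close>
  have "(\<Sum>t = l..<Suc n. b t * (d t - d (Suc t))) \<le> b n * (D - d (Suc n))" if "l \<le> n" for n
    using that
  proof (induction n rule: dec_induct)
    case base
    then show ?case using nonneg d by (auto intro: mult_left_mono)
  next
    case (step n)
    have "(\<Sum>t = l..<Suc (Suc n). b t * (d t - d (Suc t)))
      \<le> b n * (D - d (Suc n)) + b (Suc n) * (d (Suc n) - d (Suc (Suc n)))"
      using step by simp
    also have "b n * (D - d (Suc n)) \<le> b (Suc n) * (D - d (Suc n))"
      using mono d by (intro mult_right_mono) auto
    finally show ?case by (simp add: algebra_simps)
  qed
  from this[of "N - 1"] assms(1)
  have "(\<Sum>t = l..<N. b t * (d t - d (Suc t))) \<le> b (N - 1) * (D - d N)" by simp
  also have "\<dots> \<le> b (N - 1) * D" using nonneg d by (intro mult_left_mono) auto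
  finally show ?thesis .
qed

section \<open>The stochastic approximation recursion and its measurability\<close>

text \<open>The stepsizes are only assumed positive and nonincreasing; the explicit ones are
  substituted after the expected gap has been bounded.\<close>

locale stochastic_approximation = prob_space P
  for P :: "'w measure" +
  fixes X :: "'a::euclidean_space set"
    and \<Phi> :: "'a \<Rightarrow> 'b::second_countable_topology \<Rightarrow> 'a"
    and F :: "'a \<Rightarrow> 'a"
    and \<xi> :: "'w \<Rightarrow> 'b"
    and \<xi>s :: "nat \<Rightarrow> 'w \<Rightarrow> 'b"
    and x0 :: "'w \<Rightarrow> 'a"
    and \<gamma> :: "nat \<Rightarrow> real"
    and M C :: real
  assumes closed: "closed X" and convex: "convex X" and nonempty: "X \<noteq> {}"
    and norm_le: "\<And>x. x \<in> X \<Longrightarrow> norm x \<le> M"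
    and \<xi> [measurable]: "\<xi> \<in> borel_measurable P"
    and \<Phi>: "(\<lambda>(x, z). \<Phi> x z) \<in> borel_measurable (restrict_space borel (X \<times> UNIV))"
    and F: "\<And>x. x \<in> X \<Longrightarrow> F x = expectation (\<lambda>\<omega>. \<Phi> x (\<xi> \<omega>))"
    and monotone: "monotone_operator_on X F"
    and continuous: "continuous_on X F"
    and C: "C \<ge> 0"
    and \<Phi>_square: "\<And>x. x \<in> X \<Longrightarrow> integrable P (\<lambda>\<omega>. (norm (\<Phi> x (\<xi> \<omega>)))\<^sup>2)"
      "\<And>x. x \<in> X \<Longrightarrow> expectation (\<lambda>\<omega>. (norm (\<Phi> x (\<xi> \<omega>)))\<^sup>2) \<le> C\<^sup>2"
    and indep: "indep_vars (\<lambda>_. borel) \<xi>s UNIV"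
    and distr: "\<And>k. distr P borel (\<xi>s k) = distr P borel \<xi>"
    and x0_in: "\<And>\<omega>. \<omega> \<in> space P \<Longrightarrow> x0 \<omega> \<in> X"
    and x0_indep: "indep_random_variables P borel x0 (Pi\<^sub>M UNIV (\<lambda>_. borel)) (\<lambda>\<omega> k. \<xi>s k \<omega>)"
    and \<gamma>_pos: "\<And>k. \<gamma> k > 0" and \<gamma>_decr: "\<And>k. \<gamma> (Suc k) \<le> \<gamma> k"
begin

abbreviation iterate :: "nat \<Rightarrow> 'w \<Rightarrow> 'a" where
  "iterate \<equiv> SA_iterate X \<Phi> \<gamma> x0 \<xi>s"

abbreviation past :: "nat \<Rightarrow> 'w measure" where
  "past \<equiv> history P x0 \<xi>s"

text \<open>A martingale difference sequence for the filtration \<open>past\<close>;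
  \<open>noise_orthogonal\<close> is the form in which this is used.\<close>

definition noise :: "nat \<Rightarrow> 'w \<Rightarrow> 'a" where
  "noise k \<omega> = \<Phi> (iterate k \<omega>) (\<xi>s k \<omega>) - F (iterate k \<omega>)"

text \<open>\<open>\<Phi>\<close> and \<open>F\<close> are only measurable on \<open>X\<close>; cutting them off outside \<open>X\<close> makes them
  globally measurable without changing the iteration.\<close>

definition \<Phi>\<^sub>X :: "'a \<Rightarrow> 'b \<Rightarrow> 'a" where
  "\<Phi>\<^sub>X x z = indicator X x *\<^sub>R \<Phi> x z"

definition noise\<^sub>X :: "'a \<Rightarrow> 'b \<Rightarrow> 'a" where
  "noise\<^sub>X x z = \<Phi>\<^sub>X x z - indicator X x *\<^sub>R F x"

lemma compact: "compact X"
  using closed norm_le by (auto simp: compact_eq_bounded_closed bounded_iff)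

lemma M_nonneg: "M \<ge> 0"
  using nonempty norm_le norm_ge_zero order_trans by blast

text \<open>Closedness of \<open>X\<close> makes the domain of the restricted space a Borel set, and
  second countability identifies the Borel sets of the product with the product
  sigma-algebra.\<close>

lemma measurable_\<Phi>\<^sub>X [measurable]: "(\<lambda>(x, z). \<Phi>\<^sub>X x z) \<in> borel_measurable (borel \<Otimes>\<^sub>M borel)"
proof -
  have "(X \<times> UNIV) \<inter> space borel \<in> sets (borel :: ('a \<times> 'b) measure)"
    using closed by (simp add: borel_closed closed_Times)
  from \<Phi>[unfolded borel_measurable_restrict_space_iff[OF this]]
  show ?thesis
    by (simp add: borel_prod \<Phi>\<^sub>X_def indicator_def case_prod_beta' mem_Times_iff)
qed

lemma measurable_noise\<^sub>X [measurable]: "(\<lambda>(x, z). noise\<^sub>X x z) \<in> borel_measurable (borel \<Otimes>\<^sub>M borel)"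
proof -
  have [measurable]: "(\<lambda>x. indicator X x *\<^sub>R F x) \<in> borel_measurable borel"
    using closed continuous by (intro borel_measurable_continuous_on_indicator borel_closed)
  show ?thesis unfolding noise\<^sub>X_def by measurable
qed

lemma iterate_in: "\<omega> \<in> space P \<Longrightarrow> iterate k \<omega> \<in> X"
  by (cases k) (auto simp: x0_in closest_point_in_set closed nonempty)

lemma measurable_past_mono: "\<lbrakk>f \<in> measurable (past j) S; j \<le> k\<rbrakk> \<Longrightarrow> f \<in> measurable (past k) S"
  using measurable_mono[OF order_refl refl sets_history_mono[of j k P x0 \<xi>s]] by auto

lemma measurable_x0 [measurable]: "x0 \<in> borel_measurable P"
  using x0_indep by (simp add: indep_random_variables_def)

lemma measurable_\<xi>s [measurable]: "\<xi>s k \<in> borel_measurable P"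
  using indep by (simp add: indep_vars_def2)

lemma measurable_from_past: "f \<in> measurable (past k) S \<Longrightarrow> f \<in> measurable P S"
  using measurable_mono[OF order_refl refl sets_history_subset[of x0 P \<xi>s k]] by auto

text \<open>Adaptedness: the update to index \<open>Suc k\<close> uses \<open>\<xi>s k\<close>,
  which \<open>past (Suc k)\<close> contains, and projection onto a closed convex set is
  continuous.\<close>

lemma iterate_past: "iterate k \<in> borel_measurable (past k)"
proof (induction k)
  case 0
  have "iterate 0 = x0" by auto
  then show ?case by (simp add: measurable_initial_history)
next
  case (Suc k)
  have [measurable]: "iterate k \<in> borel_measurable (past (Suc k))"
    using Suc by (rule measurable_past_mono) simp
  have [measurable]: "\<xi>s k \<in> borel_measurable (past (Suc k))"
    by (rule measurable_noise_history) simp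
  have [measurable]: "closest_point X \<in> borel_measurable borel"
    by (intro borel_measurable_continuous_onI continuous_on_closest_point convex closed nonempty)
  have "(\<lambda>\<omega>. closest_point X (iterate k \<omega> - \<gamma> k *\<^sub>R \<Phi>\<^sub>X (iterate k \<omega>) (\<xi>s k \<omega>))) \<in> borel_measurable (past (Suc k))"
    by measurable
  then show ?case
    by (rule measurable_cong[THEN iffD1, rotated]) (simp add: \<Phi>\<^sub>X_def iterate_in)
qed

lemma measurable_iterate [measurable]: "iterate k \<in> borel_measurable P"
  using iterate_past by (rule measurable_from_past)

lemma noise_eq: "\<omega> \<in> space P \<Longrightarrow> noise k \<omega> = noise\<^sub>X (iterate k \<omega>) (\<xi>s k \<omega>)"
  by (simp add: noise_def noise\<^sub>X_def \<Phi>\<^sub>X_def iterate_in)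

text \<open>The inequality is strict because \<open>noise j\<close> involves
  \<open>\<xi>s j\<close>, which enters \<open>past\<close> only at time
  \<open>Suc j\<close>.\<close>

lemma noise_past:
  assumes "j < k"
  shows "noise j \<in> borel_measurable (past k)"
proof -
  have [measurable]: "iterate j \<in> borel_measurable (past k)"
    using iterate_past by (rule measurable_past_mono) (use assms in simp)
  have [measurable]: "\<xi>s j \<in> borel_measurable (past k)"
    using assms by (rule measurable_noise_history)
  have "(\<lambda>\<omega>. noise\<^sub>X (iterate j \<omega>) (\<xi>s j \<omega>)) \<in> borel_measurable (past k)" by measurable
  then show ?thesis
    by (rule measurable_cong[THEN iffD1, rotated]) (simp add: noise_eq)
qed

lemma measurable_noise [measurable]: "noise k \<in> borel_measurable P"
  using noise_past[of k "Suc k"] by (intro measurable_from_past) auto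

lemma measurable_\<Phi>_iterate [measurable]: "(\<lambda>\<omega>. \<Phi> (iterate k \<omega>) (\<xi>s k \<omega>)) \<in> borel_measurable P"
proof -
  have "(\<lambda>\<omega>. \<Phi>\<^sub>X (iterate k \<omega>) (\<xi>s k \<omega>)) \<in> borel_measurable P" by measurable
  then show ?thesis
    by (rule measurable_cong[THEN iffD1, rotated]) (simp add: \<Phi>\<^sub>X_def iterate_in)
qed

section \<open>Second moments and orthogonality of the noise\<close>

text \<open>A finite second moment gives a finite first moment on a probability space, so the
  expectation defining \<open>F\<close> is a genuine integral and not the default value 0.\<close>

lemma integrable_\<Phi>:
  assumes "x \<in> X"
  shows "integrable P (\<lambda>\<omega>. \<Phi> x (\<xi> \<omega>))"
proof -
  have "(\<lambda>\<omega>. \<Phi>\<^sub>X x (\<xi> \<omega>)) \<in> borel_measurable P" by measurable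
  then have m[measurable]: "(\<lambda>\<omega>. \<Phi> x (\<xi> \<omega>)) \<in> borel_measurable P" using assms by (simp add: \<Phi>\<^sub>X_def)
  have "integrable P (\<lambda>\<omega>. norm (\<Phi> x (\<xi> \<omega>)))"
    by (rule square_integrable_imp_integrable) (use \<Phi>_square assms in auto)
  then show ?thesis by (simp add: integrable_norm_iff)
qed

text \<open>Centering at the mean \<open>F x\<close> lowers the second moment by the square of
  \<open>norm (F x)\<close>, so the bound on the second moment survives.\<close>

lemma noise\<^sub>X_moments:
  assumes "x \<in> X"
  shows "integrable P (\<lambda>\<omega>. noise\<^sub>X x (\<xi> \<omega>))" "expectation (\<lambda>\<omega>. noise\<^sub>X x (\<xi> \<omega>)) = 0"
    and "integrable P (\<lambda>\<omega>. (norm (noise\<^sub>X x (\<xi> \<omega>)))\<^sup>2)"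
    and "expectation (\<lambda>\<omega>. (norm (noise\<^sub>X x (\<xi> \<omega>)))\<^sup>2) \<le> C\<^sup>2"
proof -
  note int = integrable_\<Phi>[OF assms] and sq = \<Phi>_square[OF assms]
  have w: "noise\<^sub>X x z = \<Phi> x z - F x" for z using assms by (simp add: noise\<^sub>X_def \<Phi>\<^sub>X_def)
  show "integrable P (\<lambda>\<omega>. noise\<^sub>X x (\<xi> \<omega>))" using int by (simp add: w)
  show "expectation (\<lambda>\<omega>. noise\<^sub>X x (\<xi> \<omega>)) = 0" using int F[OF assms] by (simp add: w prob_space)
  have expand: "(norm (noise\<^sub>X x z))\<^sup>2 = (norm (\<Phi> x z))\<^sup>2 - 2 * (\<Phi> x z \<bullet> F x) + (norm (F x))\<^sup>2" for z
    by (simp add: w power2_norm_eq_inner inner_diff_left inner_diff_right inner_commute)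
  show "integrable P (\<lambda>\<omega>. (norm (noise\<^sub>X x (\<xi> \<omega>)))\<^sup>2)"
    unfolding expand using int sq(1) by simp
  have "expectation (\<lambda>\<omega>. (norm (noise\<^sub>X x (\<xi> \<omega>)))\<^sup>2)
    = expectation (\<lambda>\<omega>. (norm (\<Phi> x (\<xi> \<omega>)))\<^sup>2) - 2 * (F x \<bullet> F x) + (norm (F x))\<^sup>2"
    unfolding expand using int sq(1) F[OF assms] by (simp add: prob_space)
  also have "\<dots> = expectation (\<lambda>\<omega>. (norm (\<Phi> x (\<xi> \<omega>)))\<^sup>2) - (norm (F x))\<^sup>2"
    by (simp add: power2_norm_eq_inner)
  also have "\<dots> \<le> C\<^sup>2" using sq(2) zero_le_power2[of "norm (F x)"] by linarith
  finally show "expectation (\<lambda>\<omega>. (norm (noise\<^sub>X x (\<xi> \<omega>)))\<^sup>2) \<le> C\<^sup>2" .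
qed

text \<open>The iterate is independent of \<open>\<xi>s k\<close>, so a bound valid at every fixed
  point of \<open>X\<close> carries over after freezing the iterate. The nonnegative integral comes
  first because integrability is itself a conclusion.\<close>

lemma expectation_along_iterates_le:
  fixes g :: "'a \<Rightarrow> 'b \<Rightarrow> real"
  assumes [measurable]: "(\<lambda>(x, z). g x z) \<in> borel_measurable (borel \<Otimes>\<^sub>M borel)"
    and nonneg: "\<And>x z. 0 \<le> g x z"
    and int: "\<And>x. x \<in> X \<Longrightarrow> integrable P (\<lambda>\<omega>. g x (\<xi> \<omega>))"
    and le: "\<And>x. x \<in> X \<Longrightarrow> expectation (\<lambda>\<omega>. g x (\<xi> \<omega>)) \<le> B"
  shows "integrable P (\<lambda>\<omega>. g (iterate k \<omega>) (\<xi>s k \<omega>))"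
    and "expectation (\<lambda>\<omega>. g (iterate k \<omega>) (\<xi>s k \<omega>)) \<le> B"
proof -
  \<comment> \<open>\<open>ennreal\<close> sends negative numbers to 0, so the sign of
    \<open>B\<close> matters when returning to the reals.\<close>
  have "0 \<le> B" using nonempty le nonneg by (metis all_not_in_conv integral_nonneg_AE AE_I2 order_trans)
  have "(\<integral>\<^sup>+\<omega>. ennreal (g (iterate k \<omega>) (\<xi>s k \<omega>)) \<partial>P)
    = (\<integral>\<^sup>+\<omega>. \<integral>\<^sup>+\<omega>'. ennreal (g (iterate k \<omega>) (\<xi> \<omega>')) \<partial>P \<partial>P)"
    using nn_integral_indep_random_variables[OF indep_history_noise[OF indep x0_indep iterate_past] \<xi> distr,
      where f = "\<lambda>(x, z). ennreal (g x z)"] by simp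
  also have "\<dots> \<le> (\<integral>\<^sup>+\<omega>. ennreal B \<partial>P)"
  proof (rule nn_integral_mono)
    fix \<omega> assume "\<omega> \<in> space P"
    then have "iterate k \<omega> \<in> X" by (rule iterate_in)
    then show "(\<integral>\<^sup>+\<omega>'. ennreal (g (iterate k \<omega>) (\<xi> \<omega>')) \<partial>P) \<le> ennreal B"
      using int le nonneg by (subst nn_integral_eq_integral) (auto intro: ennreal_leI)
  qed
  finally have bound: "(\<integral>\<^sup>+\<omega>. ennreal (g (iterate k \<omega>) (\<xi>s k \<omega>)) \<partial>P) \<le> ennreal B"
    by (simp add: emeasure_space_1)
  show int': "integrable P (\<lambda>\<omega>. g (iterate k \<omega>) (\<xi>s k \<omega>))"
    using bound nonneg by (intro integrableI_nonneg) (auto intro: le_less_trans)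
  show "expectation (\<lambda>\<omega>. g (iterate k \<omega>) (\<xi>s k \<omega>)) \<le> B"
    using bound nonneg \<open>0 \<le> B\<close> by (subst (asm) nn_integral_eq_integral[OF int']) auto
qed

lemma \<Phi>_iterate_square:
  "integrable P (\<lambda>\<omega>. (norm (\<Phi> (iterate k \<omega>) (\<xi>s k \<omega>)))\<^sup>2)"
  "expectation (\<lambda>\<omega>. (norm (\<Phi> (iterate k \<omega>) (\<xi>s k \<omega>)))\<^sup>2) \<le> C\<^sup>2"
proof -
  have eq: "(norm (\<Phi> (iterate k \<omega>) (\<xi>s k \<omega>)))\<^sup>2 = (norm (\<Phi>\<^sub>X (iterate k \<omega>) (\<xi>s k \<omega>)))\<^sup>2"
    if "\<omega> \<in> space P" for \<omega>
    using that by (simp add: \<Phi>\<^sub>X_def iterate_in)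
  have "integrable P (\<lambda>\<omega>. (norm (\<Phi>\<^sub>X (iterate k \<omega>) (\<xi>s k \<omega>)))\<^sup>2)"
    "expectation (\<lambda>\<omega>. (norm (\<Phi>\<^sub>X (iterate k \<omega>) (\<xi>s k \<omega>)))\<^sup>2) \<le> C\<^sup>2"
  proof -
    have m: "(\<lambda>(x, z). (norm (\<Phi>\<^sub>X x z))\<^sup>2) \<in> borel_measurable (borel \<Otimes>\<^sub>M borel)" by measurable
    note bounds = expectation_along_iterates_le[OF m, where B = "C\<^sup>2" and k = k]
    show "integrable P (\<lambda>\<omega>. (norm (\<Phi>\<^sub>X (iterate k \<omega>) (\<xi>s k \<omega>)))\<^sup>2)"
      by (rule bounds) (simp_all add: \<Phi>\<^sub>X_def \<Phi>_square)
    show "expectation (\<lambda>\<omega>. (norm (\<Phi>\<^sub>X (iterate k \<omega>) (\<xi>s k \<omega>)))\<^sup>2) \<le> C\<^sup>2"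
      by (rule bounds) (simp_all add: \<Phi>\<^sub>X_def \<Phi>_square)
  qed
  then show "integrable P (\<lambda>\<omega>. (norm (\<Phi> (iterate k \<omega>) (\<xi>s k \<omega>)))\<^sup>2)"
    "expectation (\<lambda>\<omega>. (norm (\<Phi> (iterate k \<omega>) (\<xi>s k \<omega>)))\<^sup>2) \<le> C\<^sup>2"
    by (subst Bochner_Integration.integrable_cong[OF refl eq] Bochner_Integration.integral_cong[OF refl eq]; simp)+
qed

lemma noise_square:
  "integrable P (\<lambda>\<omega>. (norm (noise k \<omega>))\<^sup>2)"
  "expectation (\<lambda>\<omega>. (norm (noise k \<omega>))\<^sup>2) \<le> C\<^sup>2"
proof -
  have eq: "(norm (noise k \<omega>))\<^sup>2 = (norm (noise\<^sub>X (iterate k \<omega>) (\<xi>s k \<omega>)))\<^sup>2" if "\<omega> \<in> space P" for \<omega>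
    using that by (simp add: noise_eq)
  have "integrable P (\<lambda>\<omega>. (norm (noise\<^sub>X (iterate k \<omega>) (\<xi>s k \<omega>)))\<^sup>2)"
    "expectation (\<lambda>\<omega>. (norm (noise\<^sub>X (iterate k \<omega>) (\<xi>s k \<omega>)))\<^sup>2) \<le> C\<^sup>2"
  proof -
    have m: "(\<lambda>(x, z). (norm (noise\<^sub>X x z))\<^sup>2) \<in> borel_measurable (borel \<Otimes>\<^sub>M borel)" by measurable
    note bounds = expectation_along_iterates_le[OF m, where B = "C\<^sup>2" and k = k]
    show "integrable P (\<lambda>\<omega>. (norm (noise\<^sub>X (iterate k \<omega>) (\<xi>s k \<omega>)))\<^sup>2)"
      by (rule bounds) (simp_all add: noise\<^sub>X_moments)
    show "expectation (\<lambda>\<omega>. (norm (noise\<^sub>X (iterate k \<omega>) (\<xi>s k \<omega>)))\<^sup>2) \<le> C\<^sup>2"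
      by (rule bounds) (simp_all add: noise\<^sub>X_moments)
  qed
  then show "integrable P (\<lambda>\<omega>. (norm (noise k \<omega>))\<^sup>2)"
    "expectation (\<lambda>\<omega>. (norm (noise k \<omega>))\<^sup>2) \<le> C\<^sup>2"
    by (subst Bochner_Integration.integrable_cong[OF refl eq] Bochner_Integration.integral_cong[OF refl eq]; simp)+
qed

text \<open>Given the past, the noise has mean zero: with \<open>H\<close> and the iterate frozen,
  the inner expectation vanishes by \<open>noise\<^sub>X_moments\<close>.\<close>

lemma noise_orthogonal:
  assumes H: "H \<in> borel_measurable (past k)" and sq: "integrable P (\<lambda>\<omega>. (norm (H \<omega> :: 'a))\<^sup>2)"
  shows "integrable P (\<lambda>\<omega>. H \<omega> \<bullet> noise k \<omega>)" "expectation (\<lambda>\<omega>. H \<omega> \<bullet> noise k \<omega>) = 0"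
proof -
  have [measurable]: "H \<in> borel_measurable P" using H by (rule measurable_from_past)
  show int: "integrable P (\<lambda>\<omega>. H \<omega> \<bullet> noise k \<omega>)"
  proof (rule Bochner_Integration.integrable_bound)
    show "integrable P (\<lambda>\<omega>. (norm (H \<omega>))\<^sup>2 + (norm (noise k \<omega>))\<^sup>2)"
      using sq noise_square(1) by simp
    have "\<bar>h \<bullet> w\<bar> \<le> (norm h)\<^sup>2 + (norm w)\<^sup>2" for h w :: 'a
    proof -
      have "\<bar>h \<bullet> w\<bar> \<le> norm h * norm w" by (rule Cauchy_Schwarz_ineq2)
      also have "\<dots> \<le> (norm h)\<^sup>2 + (norm w)\<^sup>2"
        using sum_squares_bound[of "norm h" "norm w"] mult_nonneg_nonneg[of "norm h" "norm w", OF norm_ge_zero norm_ge_zero]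
        by linarith
      finally show ?thesis .
    qed
    then show "AE \<omega> in P. norm (H \<omega> \<bullet> noise k \<omega>) \<le> norm ((norm (H \<omega>))\<^sup>2 + (norm (noise k \<omega>))\<^sup>2)"
      by (intro AE_I2) (simp add: abs_of_nonneg)
  qed simp
  let ?f = "\<lambda>(p, z). fst p \<bullet> noise\<^sub>X (snd p) z"
  \<comment> \<open>The noise depends on the iterate as well, so both enter jointly as one variable
    of the past.\<close>
  have "(\<lambda>\<omega>. (H \<omega>, iterate k \<omega>)) \<in> measurable (past k) (borel \<Otimes>\<^sub>M borel)"
    using H iterate_past by (rule measurable_Pair)
  note ind = indep_history_noise[OF indep x0_indep this]
  have eq: "H \<omega> \<bullet> noise k \<omega> = ?f ((H \<omega>, iterate k \<omega>), \<xi>s k \<omega>)" if "\<omega> \<in> space P" for \<omega>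
    using that by (simp add: noise_eq)
  have "expectation (\<lambda>\<omega>. H \<omega> \<bullet> noise k \<omega>) = expectation (\<lambda>\<omega>. ?f ((H \<omega>, iterate k \<omega>), \<xi>s k \<omega>))"
    using eq by (rule Bochner_Integration.integral_cong[OF refl])
  also have "\<dots> = expectation (\<lambda>\<omega>. expectation (\<lambda>\<omega>'. ?f ((H \<omega>, iterate k \<omega>), \<xi> \<omega>')))"
  proof (rule expectation_indep_random_variables[OF ind \<xi> distr])
    show "?f \<in> borel_measurable ((borel \<Otimes>\<^sub>M borel) \<Otimes>\<^sub>M borel)" by measurable
    show "integrable P (\<lambda>\<omega>. ?f ((H \<omega>, iterate k \<omega>), \<xi>s k \<omega>))"
      using int by (subst (asm) Bochner_Integration.integrable_cong[OF refl eq]) simp_all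
  qed
  also have "\<dots> = expectation (\<lambda>\<omega>. 0)"
    by (intro Bochner_Integration.integral_cong) (simp_all add: noise\<^sub>X_moments iterate_in)
  finally show "expectation (\<lambda>\<omega>. H \<omega> \<bullet> noise k \<omega>) = 0" by simp
qed

text \<open>The partial sum belongs to the past of the next noise term, so the cross term vanishes.
  Integrability and bound are proved together because orthogonality asks for a square integrable
  partial sum.\<close>

lemma noise_sum_square:
  "integrable P (\<lambda>\<omega>. (norm (\<Sum>t = l..<N. c t *\<^sub>R noise t \<omega>))\<^sup>2)
   \<and> expectation (\<lambda>\<omega>. (norm (\<Sum>t = l..<N. c t *\<^sub>R noise t \<omega>))\<^sup>2) \<le> C\<^sup>2 * (\<Sum>t = l..<N. (c t)\<^sup>2)"
proof (induction N)
  case (Suc N)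
  let ?S = "\<lambda>\<omega>. \<Sum>t = l..<N. c t *\<^sub>R noise t \<omega>"
  show ?case
  proof (cases "l \<le> N")
    case True
    have S: "?S \<in> borel_measurable (past N)"
      by (intro borel_measurable_sum borel_measurable_scaleR noise_past) auto
    note orth = noise_orthogonal[OF S conjunct1[OF Suc]] and sq = noise_square[of N]
    have expand: "(norm (\<Sum>t = l..<Suc N. c t *\<^sub>R noise t \<omega>))\<^sup>2
      = (norm (?S \<omega>))\<^sup>2 + 2 * c N * (?S \<omega> \<bullet> noise N \<omega>) + (c N)\<^sup>2 * (norm (noise N \<omega>))\<^sup>2" for \<omega>
      using True by (simp only: power2_norm_eq_inner sum.atLeastLessThan_Suc)
        (simp add: inner_add_left inner_add_right inner_commute power2_eq_square)
    have "expectation (\<lambda>\<omega>. (norm (\<Sum>t = l..<Suc N. c t *\<^sub>R noise t \<omega>))\<^sup>2)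
      = expectation (\<lambda>\<omega>. (norm (?S \<omega>))\<^sup>2) + (c N)\<^sup>2 * expectation (\<lambda>\<omega>. (norm (noise N \<omega>))\<^sup>2)"
      unfolding expand using Suc orth sq by simp
    also have "\<dots> \<le> C\<^sup>2 * (\<Sum>t = l..<N. (c t)\<^sup>2) + (c N)\<^sup>2 * C\<^sup>2"
      using Suc sq by (intro add_mono mult_left_mono) auto
    also have "\<dots> = C\<^sup>2 * (\<Sum>t = l..<Suc N. (c t)\<^sup>2)" using True by (simp add: algebra_simps)
    finally show ?thesis unfolding expand using Suc orth sq by simp
  qed simp
qed simp

text \<open>The square of a mean is at most the mean of the square, since the variance is
  nonnegative. Orthogonality thus bounds the accumulated noise by a root of a sum of squares rather
  than by a sum.\<close>

lemma noise_sum_norm: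
  "integrable P (\<lambda>\<omega>. norm (\<Sum>t = l..<N. c t *\<^sub>R noise t \<omega>))"
  "expectation (\<lambda>\<omega>. norm (\<Sum>t = l..<N. c t *\<^sub>R noise t \<omega>)) \<le> C * sqrt (\<Sum>t = l..<N. (c t)\<^sup>2)"
proof -
  let ?Z = "\<lambda>\<omega>. norm (\<Sum>t = l..<N. c t *\<^sub>R noise t \<omega>)"
  note sq = noise_sum_square[of c l N]
  show int: "integrable P ?Z"
    by (rule square_integrable_imp_integrable) (measurable, rule conjunct1[OF sq])
  have "(expectation ?Z)\<^sup>2 \<le> expectation (\<lambda>\<omega>. (?Z \<omega>)\<^sup>2)"
    using variance_positive[of ?Z] sq int by (simp add: variance_eq)
  also have "\<dots> \<le> C\<^sup>2 * (\<Sum>t = l..<N. (c t)\<^sup>2)" using sq by simp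
  also have "\<dots> = (C * sqrt (\<Sum>t = l..<N. (c t)\<^sup>2))\<^sup>2"
    by (simp add: power_mult_distrib sum_nonneg)
  finally show "expectation ?Z \<le> C * sqrt (\<Sum>t = l..<N. (c t)\<^sup>2)"
    by (rule power2_le_imp_le) (use C in \<open>simp add: sum_nonneg\<close>)
qed

section \<open>From the pathwise estimate to the expected gap\<close>

lemma descent_step:
  assumes "\<omega> \<in> space P" "y \<in> X"
  shows "\<gamma> t powr r * (\<Phi> (iterate t \<omega>) (\<xi>s t \<omega>) \<bullet> (iterate t \<omega> - y))
    \<le> 1 / 2 * \<gamma> t powr (r - 1) * ((norm (iterate t \<omega> - y))\<^sup>2 - (norm (iterate (Suc t) \<omega> - y))\<^sup>2)
      + 1 / 2 * \<gamma> t powr (r + 1) * (norm (\<Phi> (iterate t \<omega>) (\<xi>s t \<omega>)))\<^sup>2"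
proof -
  define x g p where "x = iterate t \<omega>" and "g = \<gamma> t" and "p = \<Phi> (iterate t \<omega>) (\<xi>s t \<omega>)"
  have "g > 0" by (simp add: g_def \<gamma>_pos)
  \<comment> \<open>The point \<open>y\<close> is its own projection, so nonexpansiveness applies to
    the whole update.\<close>
  have "norm (iterate (Suc t) \<omega> - y) = dist (closest_point X (x - g *\<^sub>R p)) (closest_point X y)"
    using assms by (simp add: x_def g_def p_def dist_norm closest_point_self)
  also have "\<dots> \<le> norm (x - g *\<^sub>R p - y)"
    using closest_point_lipschitz[OF convex closed nonempty] by (simp add: dist_norm)
  finally have "(norm (iterate (Suc t) \<omega> - y))\<^sup>2 \<le> (norm (x - g *\<^sub>R p - y))\<^sup>2"
    by (rule power_mono) simp
  also have "\<dots> = (norm (x - y))\<^sup>2 - 2 * g * (p \<bullet> (x - y)) + g\<^sup>2 * (norm p)\<^sup>2"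
    by (simp only: power2_norm_eq_inner)
       (simp add: inner_diff_left inner_diff_right inner_commute power2_eq_square algebra_simps)
  finally have *: "2 * g * (p \<bullet> (x - y)) \<le> (norm (x - y))\<^sup>2 - (norm (iterate (Suc t) \<omega> - y))\<^sup>2 + g\<^sup>2 * (norm p)\<^sup>2"
    by simp
  \<comment> \<open>Multiplying the expanded square by \<open>g powr (r - 1) / 2\<close> turns the
    factor \<open>2 * g\<close> into \<open>g powr r\<close> and \<open>g\<^sup>2\<close> into half
    of \<open>g powr (r + 1)\<close>.\<close>
  have "g powr r = g powr (r - 1 + 1)" "g powr (r + 1) = g powr (r - 1 + 2)"
    by (simp_all add: add.commute)
  then have pw: "g powr r = g powr (r - 1) * g" "g powr (r + 1) = g powr (r - 1) * g\<^sup>2"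
    using \<open>g > 0\<close> by (simp_all only: powr_add) simp_all
  have "g powr r * (p \<bullet> (x - y)) = 1 / 2 * g powr (r - 1) * (2 * g * (p \<bullet> (x - y)))"
    by (simp add: pw)
  also have "\<dots> \<le> 1 / 2 * g powr (r - 1) *
      ((norm (x - y))\<^sup>2 - (norm (iterate (Suc t) \<omega> - y))\<^sup>2 + g\<^sup>2 * (norm p)\<^sup>2)"
    using * by (rule mult_left_mono) simp
  also have "\<dots> = 1 / 2 * g powr (r - 1) * ((norm (x - y))\<^sup>2 - (norm (iterate (Suc t) \<omega> - y))\<^sup>2)
      + 1 / 2 * g powr (r + 1) * (norm p)\<^sup>2"
    unfolding pw(2) by (simp only: distrib_left mult.assoc)
  finally show ?thesis by (simp add: x_def g_def p_def)
qed

text \<open>Here \<open>r \<le> 1\<close> enters: a nonpositive exponent turns decreasing stepsizes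
  into the nondecreasing weights that summation by parts needs.\<close>

lemma \<gamma>_powr_mono:
  assumes "r \<le> 1"
  shows "\<gamma> t powr (r - 1) \<le> \<gamma> (Suc t) powr (r - 1)"
  using assms \<gamma>_decr[of t] \<gamma>_pos by (intro powr_mono2') auto

text \<open>The supremum over \<open>y\<close> precedes the expectation, so the right-hand side must
  be free of \<open>y\<close>. Splitting the noise term leaves \<open>y\<close> only in an inner
  product with the weighted noise sum, handled by Cauchy-Schwarz; the remaining pairing with the
  iterates will have mean zero.\<close>

lemma gap_average_le:
  assumes \<omega>: "\<omega> \<in> space P" and "r \<le> 1" "l < N"
  shows "(\<Sum>t = l..<N. \<gamma> t powr r) * gap X F (aSA_average X \<Phi> \<gamma> x0 \<xi>s l r N \<omega>)
    \<le> 2 * M\<^sup>2 * \<gamma> (N - 1) powr (r - 1)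
      + (\<Sum>t = l..<N. 1 / 2 * \<gamma> t powr (r + 1) * (norm (\<Phi> (iterate t \<omega>) (\<xi>s t \<omega>)))\<^sup>2)
      - (\<Sum>t = l..<N. \<gamma> t powr r * (iterate t \<omega> \<bullet> noise t \<omega>))
      + M * norm (\<Sum>t = l..<N. \<gamma> t powr r *\<^sub>R noise t \<omega>)" (is "?c * gap X F ?a \<le> ?R")
proof -
  have "?c > 0" using \<gamma>_pos assms by (intro sum_pos) (auto simp: order_less_imp_not_eq2)
  have a: "?c *\<^sub>R ?a = (\<Sum>t = l..<N. \<gamma> t powr r *\<^sub>R iterate t \<omega>)"
    using \<open>?c > 0\<close> by (simp add: aSA_average_def)
  have main: "?c * (F y \<bullet> (?a - y)) \<le> ?R" if y: "y \<in> X" for y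
  proof -
    let ?x = "\<lambda>t. iterate t \<omega>" and ?p = "\<lambda>t. \<Phi> (iterate t \<omega>) (\<xi>s t \<omega>)" and ?S = "\<Sum>t = l..<N. \<gamma> t powr r *\<^sub>R noise t \<omega>"
    have "?c * (F y \<bullet> (?a - y)) = F y \<bullet> (?c *\<^sub>R ?a - ?c *\<^sub>R y)"
      by (simp add: scaleR_diff_right[symmetric])
    also have "\<dots> = (\<Sum>t = l..<N. \<gamma> t powr r * (F y \<bullet> (?x t - y)))"
      unfolding a by (simp add: inner_diff_right inner_sum_right right_diff_distrib sum_subtractf sum_distrib_right)
    also have "\<dots> \<le> (\<Sum>t = l..<N. \<gamma> t powr r * (?p t \<bullet> (?x t - y))
        - \<gamma> t powr r * (?x t \<bullet> noise t \<omega>) + (\<gamma> t powr r *\<^sub>R noise t \<omega>) \<bullet> y)"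
    proof (rule sum_mono)
      fix t
      have "0 \<le> (F (?x t) - F y) \<bullet> (?x t - y)"
        using monotone iterate_in[OF \<omega>, of t] y by (auto simp: monotone_operator_on_def)
      then have "F y \<bullet> (?x t - y) \<le> (?p t - noise t \<omega>) \<bullet> (?x t - y)"
        by (simp add: noise_def inner_diff_left)
      then have "\<gamma> t powr r * (F y \<bullet> (?x t - y)) \<le> \<gamma> t powr r * ((?p t - noise t \<omega>) \<bullet> (?x t - y))"
        by (rule mult_left_mono) simp
      also have "\<dots> = \<gamma> t powr r * (?p t \<bullet> (?x t - y))
        - \<gamma> t powr r * (?x t \<bullet> noise t \<omega>) + (\<gamma> t powr r *\<^sub>R noise t \<omega>) \<bullet> y"
        by (simp add: inner_diff_left inner_diff_right inner_commute algebra_simps)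
      finally show "\<gamma> t powr r * (F y \<bullet> (?x t - y)) \<le> \<gamma> t powr r * (?p t \<bullet> (?x t - y))
        - \<gamma> t powr r * (?x t \<bullet> noise t \<omega>) + (\<gamma> t powr r *\<^sub>R noise t \<omega>) \<bullet> y" .
    qed
    also have "\<dots> = (\<Sum>t = l..<N. \<gamma> t powr r * (?p t \<bullet> (?x t - y)))
      - (\<Sum>t = l..<N. \<gamma> t powr r * (?x t \<bullet> noise t \<omega>)) + ?S \<bullet> y"
      by (simp add: sum.distrib sum_subtractf inner_sum_left)
    also have "?S \<bullet> y \<le> M * norm ?S"
    proof -
      have "?S \<bullet> y \<le> norm ?S * norm y" by (rule norm_cauchy_schwarz)
      also have "\<dots> \<le> norm ?S * M" using norm_le[OF y] by (rule mult_left_mono) simp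
      finally show ?thesis by (simp add: mult.commute)
    qed
    also have "(\<Sum>t = l..<N. \<gamma> t powr r * (?p t \<bullet> (?x t - y)))
      \<le> (\<Sum>t = l..<N. 1 / 2 * \<gamma> t powr (r - 1) * ((norm (?x t - y))\<^sup>2 - (norm (?x (Suc t) - y))\<^sup>2)
        + 1 / 2 * \<gamma> t powr (r + 1) * (norm (?p t))\<^sup>2)"
      by (intro sum_mono descent_step \<omega> y)
    also have "\<dots> = (\<Sum>t = l..<N. 1 / 2 * \<gamma> t powr (r - 1) * ((norm (?x t - y))\<^sup>2 - (norm (?x (Suc t) - y))\<^sup>2))
        + (\<Sum>t = l..<N. 1 / 2 * \<gamma> t powr (r + 1) * (norm (?p t))\<^sup>2)"
      by (rule sum.distrib)
    \<comment> \<open>Points of \<open>X\<close> are at distance at most \<open>2 * M\<close>,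
      whence the constant \<open>2 * M\<^sup>2\<close>.\<close>
    also have "(\<Sum>t = l..<N. 1 / 2 * \<gamma> t powr (r - 1) * ((norm (?x t - y))\<^sup>2 - (norm (?x (Suc t) - y))\<^sup>2))
      \<le> 1 / 2 * \<gamma> (N - 1) powr (r - 1) * (2 * M)\<^sup>2"
    proof (rule sum_weighted_differences_le)
      fix t
      have "norm (?x t - y) \<le> norm (?x t) + norm y" by (rule norm_triangle_ineq4)
      also have "\<dots> \<le> 2 * M" using norm_le[OF y] norm_le[OF iterate_in[OF \<omega>, of t]] by simp
      finally show "(norm (?x t - y))\<^sup>2 \<le> (2 * M)\<^sup>2" by (rule power_mono) simp
    qed (use assms in \<open>auto intro: \<gamma>_powr_mono\<close>)
    finally show ?thesis by (simp add: algebra_simps)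
  qed
  have "gap X F ?a \<le> ?R / ?c"
    unfolding gap_def using main \<open>?c > 0\<close>
    by (intro cSUP_least nonempty) (simp add: pos_le_divide_eq mult.commute)
  then show ?thesis using \<open>?c > 0\<close> by (simp add: pos_le_divide_eq mult.commute)
qed

lemma average_in:
  assumes "\<omega> \<in> space P" "l < N"
  shows "aSA_average X \<Phi> \<gamma> x0 \<xi>s l r N \<omega> \<in> X"
proof -
  let ?c = "\<Sum>t = l..<N. \<gamma> t powr r"
  have "?c > 0" using \<gamma>_pos assms by (intro sum_pos) (auto simp: order_less_imp_not_eq2)
  then have "(\<Sum>t = l..<N. (\<gamma> t powr r / ?c) *\<^sub>R iterate t \<omega>) \<in> X"
    using iterate_in[OF assms(1)]
    by (intro convex_sum convex) (auto simp: sum_divide_distrib[symmetric])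
  also have "(\<Sum>t = l..<N. (\<gamma> t powr r / ?c) *\<^sub>R iterate t \<omega>) = aSA_average X \<Phi> \<gamma> x0 \<xi>s l r N \<omega>"
    by (simp add: aSA_average_def scaleR_sum_right divide_inverse mult.commute)
  finally show ?thesis .
qed

text \<open>The average lies in \<open>X\<close>, so it may serve as \<open>y\<close>. This lower
  bound supplies the other side of the domination used for integrability.\<close>

lemma gap_average_nonneg:
  assumes "\<omega> \<in> space P" "l < N"
  shows "0 \<le> gap X F (aSA_average X \<Phi> \<gamma> x0 \<xi>s l r N \<omega>)"
proof -
  let ?a = "aSA_average X \<Phi> \<gamma> x0 \<xi>s l r N \<omega>"
  have "F ?a \<bullet> (?a - ?a) \<le> gap X F ?a"
    unfolding gap_def by (rule cSUP_upper[OF average_in[OF assms] bdd_above_gap_values[OF compact continuous]])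
  then show ?thesis by simp
qed

lemma measurable_gap_average [measurable]:
  "(\<lambda>\<omega>. gap X F (aSA_average X \<Phi> \<gamma> x0 \<xi>s l r N \<omega>)) \<in> borel_measurable P"
proof -
  obtain B where "lipschitz_on B UNIV (gap X F)"
    using gap_lipschitz[OF compact nonempty continuous] by blast
  then have [measurable]: "gap X F \<in> borel_measurable borel"
    by (intro borel_measurable_continuous_onI lipschitz_on_continuous_on)
  show ?thesis unfolding aSA_average_def by measurable
qed

theorem expectation_gap_average_le:
  assumes "r \<le> 1" "l < N"
  shows "integrable P (\<lambda>\<omega>. gap X F (aSA_average X \<Phi> \<gamma> x0 \<xi>s l r N \<omega>))"
    and "0 \<le> expectation (\<lambda>\<omega>. gap X F (aSA_average X \<Phi> \<gamma> x0 \<xi>s l r N \<omega>))"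
    and "(\<Sum>t = l..<N. \<gamma> t powr r) * expectation (\<lambda>\<omega>. gap X F (aSA_average X \<Phi> \<gamma> x0 \<xi>s l r N \<omega>))
      \<le> 2 * M\<^sup>2 * \<gamma> (N - 1) powr (r - 1) + C\<^sup>2 / 2 * (\<Sum>t = l..<N. \<gamma> t powr (r + 1))
        + M * C * sqrt (\<Sum>t = l..<N. (\<gamma> t powr r)\<^sup>2)"
proof -
  let ?c = "\<Sum>t = l..<N. \<gamma> t powr r" and ?G = "\<lambda>\<omega>. gap X F (aSA_average X \<Phi> \<gamma> x0 \<xi>s l r N \<omega>)"
  let ?A = "2 * M\<^sup>2 * \<gamma> (N - 1) powr (r - 1)"
  let ?B = "\<lambda>\<omega>. \<Sum>t = l..<N. 1 / 2 * \<gamma> t powr (r + 1) * (norm (\<Phi> (iterate t \<omega>) (\<xi>s t \<omega>)))\<^sup>2"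
  let ?D = "\<lambda>\<omega>. \<Sum>t = l..<N. \<gamma> t powr r * (iterate t \<omega> \<bullet> noise t \<omega>)"
  let ?S = "\<lambda>\<omega>. norm (\<Sum>t = l..<N. \<gamma> t powr r *\<^sub>R noise t \<omega>)"
  let ?R = "\<lambda>\<omega>. ?A + ?B \<omega> - ?D \<omega> + M * ?S \<omega>"
  have c: "?c > 0" using \<gamma>_pos assms by (intro sum_pos) (auto simp: order_less_imp_not_eq2)
  have "integrable P (\<lambda>\<omega>. (norm (iterate t \<omega>))\<^sup>2)" for t
    using norm_le[OF iterate_in] by (intro integrable_const_bound[where B = "M\<^sup>2"] AE_I2) (auto intro: power_mono)
  note orth = noise_orthogonal[OF iterate_past this]
  have intB: "integrable P ?B" and intD: "integrable P ?D"
    using \<Phi>_iterate_square orth by auto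
  note S = noise_sum_norm[of "\<lambda>t. \<gamma> t powr r" l N]
  have intR: "integrable P ?R" using intB intD S(1) by simp
  have nonneg: "0 \<le> ?G \<omega>" and le: "?c * ?G \<omega> \<le> ?R \<omega>" if "\<omega> \<in> space P" for \<omega>
    using gap_average_nonneg[OF that assms(2)] gap_average_le[OF that assms] by auto
  have intcG: "integrable P (\<lambda>\<omega>. ?c * ?G \<omega>)"
    using intR
  proof (rule Bochner_Integration.integrable_bound)
    show "AE \<omega> in P. norm (?c * ?G \<omega>) \<le> norm (?R \<omega>)"
      using nonneg le c by (intro AE_I2) (fastforce simp: abs_mult)
  qed simp
  then show "integrable P ?G" using c by simp
  show "0 \<le> expectation ?G" using nonneg by (intro integral_nonneg_AE AE_I2) auto
  have "?c * expectation ?G = expectation (\<lambda>\<omega>. ?c * ?G \<omega>)" by simp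
  also have "\<dots> \<le> expectation ?R" using intcG intR le by (rule integral_mono)
  also have "\<dots> = ?A + expectation ?B - expectation ?D + M * expectation ?S"
    using intB intD S(1) by (simp add: prob_space)
  \<comment> \<open>Each summand pairs an iterate, known at time \<open>t\<close>, with the noise of
    the same index.\<close>
  also have "expectation ?D = 0" using orth by simp
  also have "expectation ?B = (\<Sum>t = l..<N. 1 / 2 * \<gamma> t powr (r + 1) * expectation (\<lambda>\<omega>. (norm (\<Phi> (iterate t \<omega>) (\<xi>s t \<omega>)))\<^sup>2))"
    using \<Phi>_iterate_square(1) by simp
  also have "\<dots> \<le> (\<Sum>t = l..<N. 1 / 2 * \<gamma> t powr (r + 1) * C\<^sup>2)"
    using \<Phi>_iterate_square(2) by (intro sum_mono mult_left_mono) auto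
  also have "\<dots> = C\<^sup>2 / 2 * (\<Sum>t = l..<N. \<gamma> t powr (r + 1))"
    by (simp add: sum_distrib_left mult.commute mult.left_commute)
  also have "M * expectation ?S \<le> M * (C * sqrt (\<Sum>t = l..<N. (\<gamma> t powr r)\<^sup>2))"
    using S(2) M_nonneg by (rule mult_left_mono)
  finally show "?c * expectation ?G \<le> 2 * M\<^sup>2 * \<gamma> (N - 1) powr (r - 1) + C\<^sup>2 / 2 * (\<Sum>t = l..<N. \<gamma> t powr (r + 1))
        + M * C * sqrt (\<Sum>t = l..<N. (\<gamma> t powr r)\<^sup>2)"
    by (simp add: mult.assoc)
qed

end

section \<open>Rates for the explicit stepsizes\<close>

text \<open>All three terms on the left have order at most \<open>(1 - r) / 2\<close> in
  \<open>N\<close>, and the sum of the weights has order at least \<open>1 - r / 2\<close>, a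
  difference of one half. At r = 1 two of the power sums have exponent -1;
  \<open>sum_powr_window_le\<close> covers them because \<open>lam\<close> is fixed.\<close>

lemma window_rate:
  assumes "M > 0" "C > 0" "0 < lam" "lam < 1"
  obtains K where "\<And>N l. \<lbrakk>real N > 2 / (1 - lam); l = window_start lam N\<rbrakk> \<Longrightarrow>
    2 * M\<^sup>2 * stepsize M C r (N - 1) powr (r - 1) + C\<^sup>2 / 2 * (\<Sum>t = l..<N. stepsize M C r t powr (r + 1))
      + M * C * sqrt (\<Sum>t = l..<N. (stepsize M C r t powr r)\<^sup>2)
    \<le> K / sqrt (real N) * (\<Sum>t = l..<N. stepsize M C r t powr r)"
proof -
  define a where "a = stepsize M C r 0"
  have a: "a > 0" unfolding a_def by (rule stepsize_pos[OF assms(1,2)])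
  let ?g = "stepsize M C r"
  have g: "?g k powr p = a powr p * (real k + 1) powr (- p / 2)" for k p
    unfolding a_def by (rule stepsize_powr[OF assms(1,2)])
  obtain K1 where K1: "K1 > 0" "\<And>N l. lam * real N \<le> real l \<Longrightarrow>
      (\<Sum>k = l..<N. (real k + 1) powr (- (r + 1) / 2)) \<le> K1 * real N powr (- (r + 1) / 2 + 1)"
    using sum_powr_window_le[OF assms(3,4)] by blast
  obtain K2 where K2: "K2 > 0" "\<And>N l. lam * real N \<le> real l \<Longrightarrow>
      (\<Sum>k = l..<N. (real k + 1) powr (- (2 * r) / 2)) \<le> K2 * real N powr (- (2 * r) / 2 + 1)"
    using sum_powr_window_le[OF assms(3,4)] by blast
  obtain c where c: "c > 0" "\<And>N l. \<lbrakk>real l < lam * real N + 1; real N > 2 / (1 - lam)\<rbrakk>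
      \<Longrightarrow> c * real N powr (- r / 2 + 1) \<le> (\<Sum>k = l..<N. (real k + 1) powr (- r / 2))"
    using sum_powr_window_ge[OF assms(3,4)] by blast
  define D where "D = 2 * M\<^sup>2 * a powr (r - 1) + C\<^sup>2 / 2 * (a powr (r + 1) * K1) + M * C * (a powr r * sqrt K2)"
  have "D \<ge> 0" unfolding D_def using assms a K1 K2 by (intro add_nonneg_nonneg mult_nonneg_nonneg) auto
  show thesis
  proof
    fix N l assume N2: "real N > 2 / (1 - lam)" and l: "l = window_start lam N"
    have N: "real N > 0" using N2 assms by (smt (verit) divide_pos_pos)
    note lb = window_start_bounds[OF assms(3), of N, folded l]
    let ?n = "real N powr ((1 - r) / 2)"
    have 1: "?g (N - 1) powr (r - 1) = a powr (r - 1) * ?n"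
      unfolding g using N by (simp add: of_nat_diff)
    have e: "- (r + 1) / 2 + 1 = (1 - r) / 2" by (simp add: field_simps)
    have "(\<Sum>t = l..<N. ?g t powr (r + 1)) = a powr (r + 1) * (\<Sum>t = l..<N. (real t + 1) powr (- (r + 1) / 2))"
      unfolding g by (rule sum_distrib_left[symmetric])
    also have "\<dots> \<le> a powr (r + 1) * (K1 * ?n)"
      using K1(2)[OF lb(1)] unfolding e by (rule mult_left_mono) simp
    finally have 2: "(\<Sum>t = l..<N. ?g t powr (r + 1)) \<le> a powr (r + 1) * (K1 * ?n)" .
    have "?g t powr r * ?g t powr r = ?g t powr (2 * r)" for t
      by (simp add: powr_add[symmetric])
    then have "(\<Sum>t = l..<N. (?g t powr r)\<^sup>2) = (\<Sum>t = l..<N. ?g t powr (2 * r))"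
      by (simp add: power2_eq_square)
    also have "\<dots> = a powr (2 * r) * (\<Sum>t = l..<N. (real t + 1) powr (- (2 * r) / 2))"
      unfolding g by (rule sum_distrib_left[symmetric])
    also have "\<dots> \<le> a powr (2 * r) * (K2 * real N powr (- (2 * r) / 2 + 1))"
      using K2(2)[OF lb(1)] by (rule mult_left_mono) simp
    also have "\<dots> = (a powr r * sqrt K2 * ?n)\<^sup>2"
    proof -
      have "(a powr r)\<^sup>2 = a powr (2 * r)" "?n\<^sup>2 = real N powr (- (2 * r) / 2 + 1)"
        by (simp_all add: power2_eq_square powr_add[symmetric])
      then show ?thesis using K2(1) by (simp add: power_mult_distrib)
    qed
    finally have 3: "sqrt (\<Sum>t = l..<N. (?g t powr r)\<^sup>2) \<le> a powr r * sqrt K2 * ?n"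
      using K2(1) by (intro real_le_lsqrt) auto
    have "2 * M\<^sup>2 * ?g (N - 1) powr (r - 1) + C\<^sup>2 / 2 * (\<Sum>t = l..<N. ?g t powr (r + 1))
        + M * C * sqrt (\<Sum>t = l..<N. (?g t powr r)\<^sup>2)
      \<le> 2 * M\<^sup>2 * (a powr (r - 1) * ?n) + C\<^sup>2 / 2 * (a powr (r + 1) * (K1 * ?n))
        + M * C * (a powr r * sqrt K2 * ?n)"
      unfolding 1 using 2 3 assms by (intro add_mono mult_left_mono) auto
    also have "\<dots> = D * ?n" by (simp add: D_def algebra_simps)
    \<comment> \<open>Inserts the lower bound for the sum of the weights as a factor, so that it can
      be replaced by the sum itself.\<close>
    also have "\<dots> = D / (a powr r * c) / sqrt (real N) * (a powr r * (c * (?n * sqrt (real N))))"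
      using N a c(1) by simp
    also have "?n * sqrt (real N) = real N powr ((1 - r) / 2 + 1 / 2)"
      using N by (simp only: powr_add powr_half_sqrt order_less_imp_le)
    also have "(1 - r) / 2 + 1 / 2 = - r / 2 + 1" by (simp add: field_simps)
    also have "D / (a powr r * c) / sqrt (real N) * (a powr r * (c * real N powr (- r / 2 + 1)))
      \<le> D / (a powr r * c) / sqrt (real N) * (a powr r * (\<Sum>t = l..<N. (real t + 1) powr (- r / 2)))"
      using c lb(2) N2 \<open>D \<ge> 0\<close> by (intro mult_left_mono) auto
    also have "a powr r * (\<Sum>t = l..<N. (real t + 1) powr (- r / 2)) = (\<Sum>t = l..<N. ?g t powr r)"
      unfolding g by (rule sum_distrib_left)
    finally show "2 * M\<^sup>2 * ?g (N - 1) powr (r - 1) + C\<^sup>2 / 2 * (\<Sum>t = l..<N. ?g t powr (r + 1))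
        + M * C * sqrt (\<Sum>t = l..<N. (?g t powr r)\<^sup>2)
      \<le> D / (a powr r * c) / sqrt (real N) * (\<Sum>t = l..<N. ?g t powr r)" .
  qed
qed

lemma stepsize_decreasing: "\<lbrakk>M > 0; C > 0\<rbrakk> \<Longrightarrow> stepsize M C r (Suc k) \<le> stepsize M C r k"
  unfolding stepsize_def by (intro divide_left_mono mult_left_mono mult_nonneg_nonneg mult_pos_pos) auto

lemma window_start_less:
  assumes "0 < lam" "lam < 1" "real N > 2 / (1 - lam)"
  shows "window_start lam N < N"
proof -
  have "2 < real N - lam * real N" using assms by (simp add: field_simps)
  then show ?thesis using window_start_bounds(2)[OF assms(1), of N] by linarith
qed

text \<open>Treats r = 1 and \<open>r < 1\<close> at once: dividing by the positive sum of the
  weights leaves one constant \<open>K\<close> for every admissible \<open>N\<close>, as the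
  principal filter demands.\<close>

lemma expectation_gap_bigo:
  assumes "stochastic_approximation P X \<Phi> F \<xi> \<xi>s x0 (stepsize M C r) M C"
    and "M > 0" "C > 0" "r \<le> 1" "0 < lam" "lam < 1"
  shows "expectation_bigo_on P (\<lambda>N. real N > 2 / (1 - lam))
    (\<lambda>N \<omega>. gap X F (aSA_average X \<Phi> (stepsize M C r) x0 \<xi>s (window_start lam N) r N \<omega>))
    (\<lambda>N. 1 / sqrt (real N))"
proof -
  interpret stochastic_approximation P X \<Phi> F \<xi> \<xi>s x0 "stepsize M C r" M C by fact
  let ?G = "\<lambda>N \<omega>. gap X F (aSA_average X \<Phi> (stepsize M C r) x0 \<xi>s (window_start lam N) r N \<omega>)"
  obtain K where K: "\<And>N l. \<lbrakk>real N > 2 / (1 - lam); l = window_start lam N\<rbrakk> \<Longrightarrow>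
    2 * M\<^sup>2 * stepsize M C r (N - 1) powr (r - 1) + C\<^sup>2 / 2 * (\<Sum>t = l..<N. stepsize M C r t powr (r + 1))
      + M * C * sqrt (\<Sum>t = l..<N. (stepsize M C r t powr r)\<^sup>2)
    \<le> K / sqrt (real N) * (\<Sum>t = l..<N. stepsize M C r t powr r)"
    using window_rate[OF assms(2,3,5,6)] by blast
  have "integrable P (?G N) \<and> norm (expectation (?G N)) \<le> K * norm (1 / sqrt (real N))"
    if N: "real N > 2 / (1 - lam)" for N
  proof -
    define l where "l = window_start lam N"
    have l: "l < N" unfolding l_def by (rule window_start_less[OF assms(5,6) N])
    note E = expectation_gap_average_le[OF assms(4) l]
    have "(\<Sum>t = l..<N. stepsize M C r t powr r) > 0"
      using \<gamma>_pos l by (intro sum_pos) (auto simp: order_less_imp_not_eq2)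
    moreover have "(\<Sum>t = l..<N. stepsize M C r t powr r) * expectation (?G N)
      \<le> (\<Sum>t = l..<N. stepsize M C r t powr r) * (K / sqrt (real N))"
      using order_trans[OF E(3) K[OF N l_def]] by (simp add: l_def mult.commute)
    ultimately have "expectation (?G N) \<le> K / sqrt (real N)"
      by (rule mult_left_le_imp_le[rotated])
    then show ?thesis using E(1,2) by (simp add: l_def)
  qed
  then show ?thesis
    unfolding expectation_bigo_on_def by (auto intro!: bigoI[where c = K] simp: eventually_principal)
qed

theorem proposition8:
  fixes X :: "(real ^ 'n) set"
    and \<Phi> :: "real ^ 'n \<Rightarrow> real ^ 'd \<Rightarrow> real ^ 'n"
    and F :: "real ^ 'n \<Rightarrow> real ^ 'n"
    and P :: "'w measure"
    and \<xi> :: "'w \<Rightarrow> real ^ 'd"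
    and \<xi>s :: "nat \<Rightarrow> 'w \<Rightarrow> real ^ 'd"
    and x0 :: "'w \<Rightarrow> real ^ 'n"
    and \<epsilon> M C r lam :: real
  assumes "prob_space P"
    and "\<epsilon> \<ge> 0"
    and "closed X" and "bounded X" and "convex X"
    and "M > 0" and "\<And>x. x \<in> X \<Longrightarrow> norm x \<le> M"
    and "\<xi> \<in> borel_measurable P"
    and "(\<lambda>(x, z). \<Phi> x z) \<in> borel_measurable (restrict_space borel (enlargement X \<epsilon> \<times> UNIV))"
    and "\<And>x. x \<in> enlargement X \<epsilon> \<Longrightarrow> F x = prob_space.expectation P (\<lambda>\<omega>. \<Phi> x (\<xi> \<omega>))"
    and "monotone_operator_on (enlargement X \<epsilon>) F"
    and "continuous_on (enlargement X \<epsilon>) F"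
    and "C > 0"
    and "\<And>x. x \<in> enlargement X \<epsilon> \<Longrightarrow> integrable P (\<lambda>\<omega>. (norm (\<Phi> x (\<xi> \<omega>)))\<^sup>2)"
    and "\<And>x. x \<in> enlargement X \<epsilon> \<Longrightarrow>
           prob_space.expectation P (\<lambda>\<omega>. (norm (\<Phi> x (\<xi> \<omega>)))\<^sup>2) \<le> C\<^sup>2"
    and "VI_solutions X F \<noteq> {}"
    and "prob_space.indep_vars P (\<lambda>_. borel) \<xi>s UNIV"
    and "\<And>k. distr P borel (\<xi>s k) = distr P borel \<xi>"
    and "x0 \<in> borel_measurable P"
    and "\<And>\<omega>. \<omega> \<in> space P \<Longrightarrow> x0 \<omega> \<in> X"
    and "integrable P (\<lambda>\<omega>. (norm (x0 \<omega>))\<^sup>2)"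
    and "indep_random_variables P borel x0 (Pi\<^sub>M UNIV (\<lambda>_. borel)) (\<lambda>\<omega> k. \<xi>s k \<omega>)"
    and "r \<le> 1"
    and "0 < lam" and "lam < 1"
  shows
    "(r = 1 \<longrightarrow>
       expectation_bigo_on P (\<lambda>N. real N > 2 / (1 - lam))
         (\<lambda>N \<omega>. gap X F (aSA_average X \<Phi> (stepsize M C r) x0 \<xi>s (window_start lam N) r N \<omega>))
         (\<lambda>N. 1 / sqrt (real N))) \<and>
     (r < 1 \<longrightarrow>
       expectation_bigo_on P (\<lambda>N. real N > 2 / (1 - lam))
         (\<lambda>N \<omega>. gap X F (aSA_average X \<Phi> (stepsize M C r) x0 \<xi>s (window_start lam N) r N \<omega>))
         (\<lambda>N. 1 / sqrt (real N))) \<and>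
     (\<forall>r'<1. \<exists>lam\<^sub>0 N\<^sub>0. 0 < lam\<^sub>0 \<and> lam\<^sub>0 < 1 \<and> N\<^sub>0 \<ge> 1 \<and>
       (\<forall>lam' N. 0 < lam' \<and> lam' < lam\<^sub>0 \<and> N > N\<^sub>0 \<longrightarrow>
          TUB M C r' lam' N \<le> TUB M C 1 lam' N))"
proof -
  interpret prob_space P by fact
  have sub: "X \<subseteq> enlargement X \<epsilon>"
  proof
    fix x assume "x \<in> X"
    then show "x \<in> enlargement X \<epsilon>"
      using \<open>\<epsilon> \<ge> 0\<close> unfolding enlargement_def by (intro CollectI exI[of _ x] exI[of _ 0]) simp
  qed
  have "stochastic_approximation P X \<Phi> F \<xi> \<xi>s x0 (stepsize M C r) M C"
  proof
    \<comment> \<open>A solution of the variational inequality is a point of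
      \<open>X\<close>.\<close>
    show "X \<noteq> {}" using assms(16) by (auto simp: VI_solutions_def)
    show "(\<lambda>(x, z). \<Phi> x z) \<in> borel_measurable (restrict_space borel (X \<times> UNIV))"
      by (rule measurable_restrict_mono[OF assms(9)]) (use sub in auto)
    show "monotone_operator_on X F"
      using assms(11) sub unfolding monotone_operator_on_def by blast
    show "continuous_on X F" using assms(12) sub by (rule continuous_on_subset)
  qed (use assms sub stepsize_pos stepsize_decreasing in auto)
  then have "expectation_bigo_on P (\<lambda>N. real N > 2 / (1 - lam))
         (\<lambda>N \<omega>. gap X F (aSA_average X \<Phi> (stepsize M C r) x0 \<xi>s (window_start lam N) r N \<omega>))
         (\<lambda>N. 1 / sqrt (real N))"
    using assms by (intro expectation_gap_bigo)
  then show ?thesis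
    using TUB_comparison[OF \<open>M > 0\<close> \<open>C > 0\<close>] by blast
qed

end
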